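(* Let $C,Z$ be bounded operators on $\mathcal H$ and $T=CZ-ZC$. Let $(e_n)_{n\ge1}$ be an orthonormal basis of $\mathcal H$, let $(k_n)_{n\ge1}$ be a sequence of positive integers, and write $C$ and $Z$ as block matrices relative to $(e_n)$ with central (diagonal) blocks of sizes $k_n\times k_n$. Let $A_n$ and $B_n$ denote respectively the $(n,n+1)$ and $(n+1,n)$ blocks of $C$, and let $X_n$ and $Y_n$ denote respectively the $(n,n+1)$ and $(n+1,n)$ blocks of $Z$. Let $Q_n$ be the orthogonal projection onto the span of $\{e_j: 1\le j\le k_1+\cdots+k_n\}$. If at least one of $C$, $Z$ is block tridiagonal with respect to this partition, then for all $n\ge1$ $$|\operatorname{tr}(Q_nTQ_n)|\le\|A_nY_n-X_nB_n\|_1\le(\|A_n\|_1+\|B_n\|_1)\|Z\|\le k_n(\|A_n\|+\|B_n\|)\|Z\|.$$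
   Context: $\mathcal H$ is an infinite dimensional separable complex Hilbert space. $\|\cdot\|$ is the operator norm and $\|M\|_1=\operatorname{tr}((M^*M)^{1/2})$ is the trace norm of a (rectangular) matrix $M$. With $s_0=0$ and $s_n=k_1+\cdots+k_n$, and $P_n$ the projection onto the span of $e_{s_{n-1}+1},\dots,e_{s_n}$, the $(i,j)$ block of an operator $S$ is $P_iSP_j$, viewed as a $k_i\times k_j$ matrix. $S$ is block tridiagonal if its $(i,j)$ block is $0$ whenever $|i-j|>1$. *)

theory Defs
  imports
    "HOL-Analysis.Elementary_Normed_Spaces"
    "HOL-Analysis.Operator_Norm"
    "Jordan_Normal_Form.Schur_Decomposition"
begin

text \<open>The inner product is conjugate-linear in its first argument, so the product
  written \<open>\<langle>x, y\<rangle>\<close>, linear in \<open>x\<close>, is \<^term>\<open>cinner y x\<close>.\<close>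

class complex_hilbert_space = banach +
  fixes scaleC :: "complex \<Rightarrow> 'a \<Rightarrow> 'a" (infixr "*\<^sub>C" 75)
    and cinner :: "'a \<Rightarrow> 'a \<Rightarrow> complex"
  assumes scaleC_add_right: "c *\<^sub>C (x + y) = c *\<^sub>C x + c *\<^sub>C y"
    and scaleC_add_left: "(c + d) *\<^sub>C x = c *\<^sub>C x + d *\<^sub>C x"
    and scaleC_scaleC: "c *\<^sub>C d *\<^sub>C x = (c * d) *\<^sub>C x"
    and scaleC_one: "1 *\<^sub>C x = x"
    and scaleR_scaleC: "scaleR r x = complex_of_real r *\<^sub>C x"
    and cinner_commute: "cinner x y = cnj (cinner y x)"
    and cinner_add_right: "cinner x (y + z) = cinner x y + cinner x z"
    and cinner_scaleC_right: "cinner x (c *\<^sub>C y) = c * cinner x y"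
    and cinner_self: "cinner x x = complex_of_real ((norm x)\<^sup>2)"

global_interpretation complex_vector:
  vector_space "scaleC :: complex \<Rightarrow> 'a \<Rightarrow> 'a::complex_hilbert_space"
  by unfold_locales
    (simp_all add: scaleC_add_right scaleC_add_left scaleC_scaleC scaleC_one)

text \<open>For such operators \<^const>\<open>onorm\<close> is the usual operator norm.\<close>

definition bounded_clinear :: "('a::complex_hilbert_space \<Rightarrow> 'a) \<Rightarrow> bool" where
  "bounded_clinear S \<longleftrightarrow> bounded_linear S \<and> (\<forall>c x. S (c *\<^sub>C x) = c *\<^sub>C S x)"

text \<open>A space of class \<^class>\<open>complex_hilbert_space\<close> has an orthonormal basis indexed by
  \<^typ>\<open>nat\<close> exactly if it is separable and infinite dimensional.\<close>

definition orthonormal_basis :: "(nat \<Rightarrow> 'a::complex_hilbert_space) \<Rightarrow> bool" where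
  "orthonormal_basis e \<longleftrightarrow>
     (\<forall>i j. cinner (e i) (e j) = (if i = j then 1 else 0)) \<and>
     closure (complex_vector.span (range e)) = UNIV"

text \<open>Meaningful for closed complex subspaces \<open>V\<close>, in particular finite dimensional ones.\<close>

definition orth_proj :: "'a::complex_hilbert_space set \<Rightarrow> 'a \<Rightarrow> 'a" where
  "orth_proj V x = (THE y. y \<in> V \<and> (\<forall>v\<in>V. cinner v (x - y) = 0))"

text \<open>The trace of a trace class (for instance finite rank) operator on an infinite
  dimensional separable space: the common value of \<open>\<Sum>\<^sub>j \<langle>S f\<^sub>j, f\<^sub>j\<rangle>\<close> over all orthonormal
  bases \<open>f\<close>.\<close>

definition op_trace :: "('a::complex_hilbert_space \<Rightarrow> 'a) \<Rightarrow> complex" where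
  "op_trace S =
     (THE t. \<forall>f. orthonormal_basis f \<longrightarrow> (\<lambda>j. cinner (f j) (S (f j))) sums t)"

definition vec_norm2 :: "complex vec \<Rightarrow> real" where
  "vec_norm2 v = sqrt (\<Sum>i<dim_vec v. (cmod (v $ i))\<^sup>2)"

definition mat_opnorm :: "complex mat \<Rightarrow> real" where
  "mat_opnorm M = (SUP v \<in> {v \<in> carrier_vec (dim_col M). vec_norm2 v \<le> 1}. vec_norm2 (M *\<^sub>v v))"

definition mat_trace :: "complex mat \<Rightarrow> complex" where
  "mat_trace M = (\<Sum>i<dim_row M. M $$ (i, i))"

text \<open>In \<^const>\<open>scalar_prod\<close> below the entries of the second vector are conjugated, so the
  product is \<open>v\<^sup>* M v\<close>; the order on \<^typ>\<open>complex\<close> makes it real and nonnegative.\<close>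

definition mat_psd :: "complex mat \<Rightarrow> bool" where
  "mat_psd M \<longleftrightarrow> dim_row M = dim_col M \<and> mat_adjoint M = M \<and>
     (\<forall>v \<in> carrier_vec (dim_col M). (M *\<^sub>v v) \<bullet>c v \<ge> 0)"

definition mat_psd_sqrt :: "complex mat \<Rightarrow> complex mat" where
  "mat_psd_sqrt M =
     (THE R. R \<in> carrier_mat (dim_row M) (dim_col M) \<and> mat_psd R \<and> R * R = M)"

text \<open>The trace of a positive semidefinite matrix is real.\<close>

definition trace_norm :: "complex mat \<Rightarrow> real" where
  "trace_norm M = Re (mat_trace (mat_psd_sqrt (mat_adjoint M * M)))"

text \<open>All indices start at \<open>0\<close>: the basis is \<open>e 0, e 1, \<dots>\<close>, the block sizes are
  \<open>k 0, k 1, \<dots>\<close>, and the block with index \<open>n\<close> belongs to the basis vectors \<open>e j\<close> with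
  \<open>block_start k n \<le> j < block_start k (Suc n)\<close>.\<close>

definition block_start :: "(nat \<Rightarrow> nat) \<Rightarrow> nat \<Rightarrow> nat" where
  "block_start k n = (\<Sum>i<n. k i)"

text \<open>The matrix of \<open>P\<^sub>i S P\<^sub>j\<close>, as a map from the range of \<open>P\<^sub>j\<close> to the range of \<open>P\<^sub>i\<close>.\<close>

definition op_block ::
  "(nat \<Rightarrow> 'a::complex_hilbert_space) \<Rightarrow> (nat \<Rightarrow> nat) \<Rightarrow> ('a \<Rightarrow> 'a) \<Rightarrow> nat \<Rightarrow> nat \<Rightarrow> complex mat"
where
  "op_block e k S i j = Matrix.mat (k i) (k j)
     (\<lambda>(a, b). cinner (e (block_start k i + a)) (S (e (block_start k j + b))))"

definition block_tridiagonal ::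
  "(nat \<Rightarrow> 'a::complex_hilbert_space) \<Rightarrow> (nat \<Rightarrow> nat) \<Rightarrow> ('a \<Rightarrow> 'a) \<Rightarrow> bool" where
  "block_tridiagonal e k S \<longleftrightarrow>
     (\<forall>i j. \<bar>int i - int j\<bar> > 1 \<longrightarrow> op_block e k S i j = 0\<^sub>m (k i) (k j))"

end

theory Submission
  imports Defs "HOL-Analysis.L2_Norm"
begin

text \<open>If \<open>C\<close> and \<open>Z\<close> were finite matrices, the trace of their commutator would vanish. Cutting
  with \<open>Q\<^sub>n\<close> leaves a boundary term: \<open>Q\<^sub>n C Q\<^sub>n Z Q\<^sub>n\<close> and \<open>Q\<^sub>n Z Q\<^sub>n C Q\<^sub>n\<close> have the same trace, so
  only paths that leave the range of \<open>Q\<^sub>n\<close> and return to it contribute. If one of the operators is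
  block tridiagonal, such a path can only step from block \<open>n\<close> to block \<open>n + 1\<close> and back, whence
  \<open>tr (Q\<^sub>n T Q\<^sub>n) = tr (A\<^sub>n Y\<^sub>n - X\<^sub>n B\<^sub>n)\<close> (lemma \<open>commutator_trace_blocks\<close>, after the trace of the
  compression has been identified in \<open>op_trace_compression\<close>).

  What remains is about finite matrices. The three inequalities follow from the duality of the trace
  norm and the operator norm: \<open>\<bar>tr (K M)\<bar> \<le> \<parallel>K\<parallel> \<parallel>M\<parallel>\<^sub>1\<close> (\<open>trace_norm_hoelder\<close>), and for each \<open>M\<close>
  some contraction \<open>W\<close> satisfies \<open>tr (W M) = \<parallel>M\<parallel>\<^sub>1\<close> (\<open>trace_norm_attained\<close>). With \<open>K = 1\<close> this bounds
  the trace by the trace norm. Taking for \<open>W\<close> the contraction of \<open>A Y - X B\<close>, its trace norm is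
  \<open>tr (Y W A) - tr (W X B)\<close>, and the blocks \<open>X\<close>, \<open>Y\<close> have norm at most \<open>\<parallel>Z\<parallel>\<close>
  (\<open>mat_bounded_op_block\<close>). Finally, \<open>\<parallel>M\<parallel>\<^sub>1\<close> is the trace of both \<open>W M\<close> and \<open>M W\<close>, so it is at most
  \<open>\<parallel>M\<parallel>\<close> times the smaller dimension of \<open>M\<close>.

  The duality rests on singular values, that is, on existence and uniqueness of the positive square
  root of \<open>M\<^sup>* M\<close>, which come from the spectral theorem for Hermitian matrices. The latter is
  proved by adding one eigenvector at a time; a trace comparison shows that a suitable
  perturbation of the matrix, which has the eigenvectors found so far in one eigenspace, still has
  another eigenvalue.\<close>

section \<open>Adjoints, norms and traces of complex matrices\<close>

lemma mat_adjoint_carrier [simp]: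
  "A \<in> carrier_mat n m \<Longrightarrow> mat_adjoint A \<in> carrier_mat m n"
  by (auto simp: mat_adjoint_def)

lemma dim_mat_adjoint [simp]:
  "dim_row (mat_adjoint A) = dim_col A" "dim_col (mat_adjoint A) = dim_row A"
  by (simp_all add: mat_adjoint_def)

lemma mult_square_carrier [simp]:
  "A \<in> carrier_mat n n \<Longrightarrow> B \<in> carrier_mat n n \<Longrightarrow> A * B \<in> carrier_mat n n"
  by simp

lemma square_mult_vec_carrier [simp]:
  "A \<in> carrier_mat n n \<Longrightarrow> v \<in> carrier_vec n \<Longrightarrow> A *\<^sub>v v \<in> carrier_vec n"
  by simp

lemma mat_adjoint_index [simp]:
  fixes A :: "complex mat"
  assumes "i < dim_col A" "j < dim_row A"
  shows "mat_adjoint A $$ (i, j) = cnj (A $$ (j, i))"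
  using assms by (simp add: mat_adjoint_def mat_of_rows_index)

lemma row_mat_adjoint:
  fixes A :: "complex mat"
  shows "i < dim_col A \<Longrightarrow> row (mat_adjoint A) i = conjugate (col A i)"
  by (intro eq_vecI) auto

lemma mat_adjoint_mat_adjoint [simp]: "mat_adjoint (mat_adjoint A) = (A :: complex mat)"
  by (rule eq_matI) auto

lemma mat_adjoint_mult:
  fixes A B :: "complex mat"
  assumes "A \<in> carrier_mat p q" "B \<in> carrier_mat q r"
  shows "mat_adjoint (A * B) = mat_adjoint B * mat_adjoint A"
  using assms by (intro eq_matI) (auto simp: scalar_prod_def mult.commute)

lemma mat_adjoint_diag [simp]: "mat_adjoint (mat_diag n f) = mat_diag n (\<lambda>i. cnj (f i))"
  by (rule eq_matI) (auto simp: mat_diag_def)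

lemma scalar_prod_mat_adjoint:
  fixes A :: "complex mat"
  assumes "A \<in> carrier_mat p q" "v \<in> carrier_vec q" "u \<in> carrier_vec p"
  shows "(A *\<^sub>v v) \<bullet>c u = v \<bullet>c (mat_adjoint A *\<^sub>v u)"
proof -
  have "(A *\<^sub>v v) \<bullet>c u = (\<Sum>i<p. \<Sum>j<q. A $$ (i, j) * v $ j * cnj (u $ i))"
    using assms by (simp add: scalar_prod_def sum_distrib_right lessThan_atLeast0 )
  also have "\<dots> = (\<Sum>j<q. \<Sum>i<p. A $$ (i, j) * v $ j * cnj (u $ i))"
    by (rule sum.swap)
  also have "\<dots> = v \<bullet>c (mat_adjoint A *\<^sub>v u)"
    using assms by (simp add: scalar_prod_def sum_distrib_left lessThan_atLeast0 mult_ac)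
  finally show ?thesis .
qed

lemma vec_norm2_nonneg [simp]: "0 \<le> vec_norm2 v"
  by (simp add: vec_norm2_def sum_nonneg)

lemma cscalar_prod_self:
  "v \<bullet>c v = complex_of_real ((vec_norm2 v)\<^sup>2)"
proof -
  have "v \<bullet>c v = (\<Sum>i<dim_vec v. v $ i * cnj (v $ i))"
    by (simp add: scalar_prod_def lessThan_atLeast0)
  then show ?thesis
    by (simp only: vec_norm2_def complex_norm_square[symmetric] of_real_sum
      real_sqrt_pow2[OF sum_nonneg[OF zero_le_power2]] of_real_power)
qed

lemma cscalar_prod_cauchy_schwarz:
  assumes "u \<in> carrier_vec n" "v \<in> carrier_vec n"
  shows "cmod (u \<bullet>c v) \<le> vec_norm2 u * vec_norm2 v"
proof -
  have "cmod (u \<bullet>c v) \<le> (\<Sum>i<n. \<bar>cmod (u $ i)\<bar> * \<bar>cmod (v $ i)\<bar>)"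
    using assms by (auto simp: scalar_prod_def lessThan_atLeast0 norm_mult intro!: sum_norm_le)
  also have "\<dots> \<le> L2_set (\<lambda>i. cmod (u $ i)) {..<n} * L2_set (\<lambda>i. cmod (v $ i)) {..<n}"
    by (rule L2_set_mult_ineq)
  finally show ?thesis
    using assms by (simp add: vec_norm2_def L2_set_def)
qed

lemma vec_norm2_eq_0_iff: "v \<in> carrier_vec n \<Longrightarrow> vec_norm2 v = 0 \<longleftrightarrow> v = 0\<^sub>v n"
  by (auto simp: vec_norm2_def sum_nonneg_eq_0_iff)

lemma vec_norm2_unit_vec: "i < n \<Longrightarrow> vec_norm2 (unit_vec n i) = 1"
proof -
  assume "i < n"
  have "(\<Sum>j<n. (cmod (unit_vec n i $ j))\<^sup>2) = (\<Sum>j<n. if j = i then 1 else 0)"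
    by (intro sum.cong) (auto simp: unit_vec_def)
  then show ?thesis
    using \<open>i < n\<close> by (simp add: vec_norm2_def)
qed

lemma vec_norm2_smult: "vec_norm2 (c \<cdot>\<^sub>v v) = cmod c * vec_norm2 v"
  by (simp add: vec_norm2_def norm_mult power_mult_distrib real_sqrt_mult flip: sum_distrib_left)

lemma mat_trace_comm:
  assumes "A \<in> carrier_mat p q" "B \<in> carrier_mat q p"
  shows "mat_trace (A * B) = mat_trace (B * A)"
proof -
  have "mat_trace (A * B) = (\<Sum>i<p. \<Sum>j<q. A $$ (i, j) * B $$ (j, i))"
    using assms by (simp add: mat_trace_def scalar_prod_def lessThan_atLeast0)
  also have "\<dots> = (\<Sum>j<q. \<Sum>i<p. A $$ (i, j) * B $$ (j, i))"
    by (rule sum.swap)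
  also have "\<dots> = mat_trace (B * A)"
    using assms by (simp add: mat_trace_def scalar_prod_def lessThan_atLeast0 mult.commute)
  finally show ?thesis .
qed

lemma mat_trace_add:
  "A \<in> carrier_mat n n \<Longrightarrow> B \<in> carrier_mat n n \<Longrightarrow> mat_trace (A + B) = mat_trace A + mat_trace B"
  by (simp add: mat_trace_def sum.distrib)

lemma mat_trace_diff:
  "A \<in> carrier_mat n n \<Longrightarrow> B \<in> carrier_mat n n \<Longrightarrow> mat_trace (A - B) = mat_trace A - mat_trace B"
  by (simp add: mat_trace_def sum_subtractf)

lemma mat_trace_diag: "mat_trace (mat_diag n f) = (\<Sum>i<n. f i)"
  by (simp add: mat_trace_def mat_diag_def)

section \<open>Operator norm bounds\<close>

text \<open>The bound \<open>\<parallel>M\<parallel> \<le> c\<close> on the operator norm. As a predicate it is read off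
  directly from a bounded operator of which \<open>M\<close> is a compression, and it composes under
  products.\<close>

definition mat_bounded :: "real \<Rightarrow> complex mat \<Rightarrow> bool" where
  "mat_bounded c M \<longleftrightarrow> (\<forall>v \<in> carrier_vec (dim_col M). vec_norm2 (M *\<^sub>v v) \<le> c * vec_norm2 v)"

lemma mat_bounded_mult:
  assumes "mat_bounded a A" "mat_bounded b B" "A \<in> carrier_mat p q" "B \<in> carrier_mat q r" "0 \<le> a"
  shows "mat_bounded (a * b) (A * B)"
  unfolding mat_bounded_def
proof
  fix v :: "complex vec" assume "v \<in> carrier_vec (dim_col (A * B))"
  then have v: "v \<in> carrier_vec r"
    using assms by simp
  have Bv: "B *\<^sub>v v \<in> carrier_vec q"
    using assms v by simp
  have "vec_norm2 (A *\<^sub>v (B *\<^sub>v v)) \<le> a * vec_norm2 (B *\<^sub>v v)"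
    using assms Bv by (auto simp: mat_bounded_def)
  also have "\<dots> \<le> a * (b * vec_norm2 v)"
    using assms v by (intro mult_left_mono) (auto simp: mat_bounded_def)
  finally show "vec_norm2 (A * B *\<^sub>v v) \<le> a * b * vec_norm2 v"
    using assms v by (simp add: mult.assoc assoc_mult_mat_vec[of _ p q _ r])
qed

lemma mat_bounded_one: "mat_bounded 1 (1\<^sub>m n)"
  by (simp add: mat_bounded_def)

text \<open>From \<open>\<parallel>M\<^sup>* u\<parallel>\<^sup>2 = \<langle>M M\<^sup>* u, u\<rangle> \<le> c \<parallel>M\<^sup>* u\<parallel> \<parallel>u\<parallel>\<close> one factor
  \<open>\<parallel>M\<^sup>* u\<parallel>\<close> cancels.\<close>

lemma mat_bounded_adjoint:
  assumes "mat_bounded c M" "M \<in> carrier_mat p q" "0 \<le> c"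
  shows "mat_bounded c (mat_adjoint M)"
  unfolding mat_bounded_def
proof
  fix u :: "complex vec" assume "u \<in> carrier_vec (dim_col (mat_adjoint M))"
  then have u: "u \<in> carrier_vec p"
    using assms by simp
  define w where "w = mat_adjoint M *\<^sub>v u"
  have w: "w \<in> carrier_vec q"
    using assms u unfolding w_def by (intro mult_mat_vec_carrier[of _ q p]) auto
  have "(vec_norm2 w)\<^sup>2 = cmod (w \<bullet>c w)"
    by (simp add: cscalar_prod_self norm_power)
  also have "w \<bullet>c w = (M *\<^sub>v w) \<bullet>c u"
    using assms u w by (simp add: scalar_prod_mat_adjoint[of M p q] flip: w_def)
  also have "cmod \<dots> \<le> vec_norm2 (M *\<^sub>v w) * vec_norm2 u"
    using assms u w by (intro cscalar_prod_cauchy_schwarz) auto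
  also have "\<dots> \<le> c * vec_norm2 w * vec_norm2 u"
    using assms w by (intro mult_right_mono) (auto simp: mat_bounded_def)
  finally have "vec_norm2 w * vec_norm2 w \<le> c * vec_norm2 u * vec_norm2 w"
    by (simp add: power2_eq_square mult_ac)
  then show "vec_norm2 (mat_adjoint M *\<^sub>v u) \<le> c * vec_norm2 u"
    unfolding w_def[symmetric] using assms(3)
    by (cases "vec_norm2 w = 0") (auto dest: mult_right_le_imp_le simp: less_le)
qed

lemma unitary_right:
  fixes U :: "complex mat"
  assumes "U \<in> carrier_mat n n" "mat_adjoint U * U = 1\<^sub>m n"
  shows "U * mat_adjoint U = 1\<^sub>m n"
  using assms mat_mult_left_right_inverse[of "mat_adjoint U" n U] by simp

lemma vec_norm2_isometry:
  assumes "U \<in> carrier_mat m n" "mat_adjoint U * U = 1\<^sub>m n" "x \<in> carrier_vec n"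
  shows "vec_norm2 (U *\<^sub>v x) = vec_norm2 x"
proof -
  have "mat_adjoint U *\<^sub>v (U *\<^sub>v x) = x"
    using assms by (simp flip: assoc_mult_mat_vec[of _ n m _ n])
  then have "(U *\<^sub>v x) \<bullet>c (U *\<^sub>v x) = x \<bullet>c x"
    using assms by (subst scalar_prod_mat_adjoint[of U m n]) auto
  then have "(vec_norm2 (U *\<^sub>v x))\<^sup>2 = (vec_norm2 x)\<^sup>2"
    using assms by (simp add: cscalar_prod_self del: of_real_power)
  then show ?thesis
    by simp
qed

section \<open>The spectral theorem for Hermitian matrices\<close>

text \<open>The diagonal of a Schur triangular form of \<open>A\<close> consists of eigenvalues, and the trace is
  invariant under similarity. The lemma is used contrapositively, as a source of eigenvalues other
  than \<open>\<mu>\<close>.\<close>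

lemma mat_trace_single_eigenvalue:
  fixes A :: "complex mat"
  assumes A: "A \<in> carrier_mat n n" and ev: "\<And>l. eigenvalue A l \<Longrightarrow> l = \<mu>"
  shows "mat_trace A = of_nat n * \<mu>"
proof -
  obtain as where as: "char_poly A = (\<Prod>a\<leftarrow>as. [:- a, 1:])" "length as = n"
    using char_poly_factorized[OF A] by blast
  have mu: "a = \<mu>" if "a \<in> set as" for a
    using that by (intro ev) (auto simp: eigenvalue_root_char_poly[OF A] as poly_prod_list prod_list_zero_iff)
  obtain B P Q where "schur_decomposition A as = (B, P, Q)"
    by (cases "schur_decomposition A as")
  from schur_decomposition[OF A as(1) this]
  have sim: "similar_mat_wit A B P Q" and diag: "diag_mat B = as"
    by auto
  note w = similar_mat_witD2[OF A sim]
  have "mat_trace A = mat_trace (P * (B * Q))"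
    using w by (simp add: assoc_mult_mat[of _ n n _ n _ n])
  also have "\<dots> = mat_trace (B * Q * P)"
    by (rule mat_trace_comm[of _ n n]) (use w in auto)
  also have "\<dots> = mat_trace B"
    using w by (simp add: assoc_mult_mat[of _ n n _ n _ n])
  also have "\<dots> = (\<Sum>i<n. as ! i)"
    using w by (auto simp: mat_trace_def diag_mat_def simp flip: diag intro!: sum.cong)
  also have "\<dots> = (\<Sum>i<n. \<mu>)"
    using mu as(2) by (intro sum.cong) auto
  also have "\<dots> = of_nat n * \<mu>"
    by simp
  finally show ?thesis .
qed

text \<open>Translates a family of orthonormal eigenvectors into statements about the matrix \<open>V\<close>
  that has them as columns.\<close>

lemma orthonormal_columns:
  fixes A :: "complex mat"
  assumes A: "A \<in> carrier_mat n n"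
    and v: "\<And>i. i < k \<Longrightarrow> v i \<in> carrier_vec n"
    and orth: "\<And>i j. i < k \<Longrightarrow> j < k \<Longrightarrow> v i \<bullet>c v j = (if i = j then 1 else 0)"
    and ev: "\<And>i. i < k \<Longrightarrow> A *\<^sub>v v i = l i \<cdot>\<^sub>v v i"
  defines "V \<equiv> Matrix.mat n k (\<lambda>(a, i). v i $ a)"
  shows "V \<in> carrier_mat n k"
    and "mat_adjoint V * V = 1\<^sub>m k"
    and "A * V = V * mat_diag k l"
    and "\<And>x i. x \<in> carrier_vec n \<Longrightarrow> i < k \<Longrightarrow> (mat_adjoint V *\<^sub>v x) $ i = x \<bullet>c v i"
proof -
  show V: "V \<in> carrier_mat n k"
    by (simp add: V_def)
  have col: "col V i = v i" if "i < k" for i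
    using that v[OF that] by (intro eq_vecI) (auto simp: V_def)
  show inner: "(mat_adjoint V *\<^sub>v x) $ i = x \<bullet>c v i" if "x \<in> carrier_vec n" "i < k" for x i
    using that v[OF that(2)] by (auto simp: V_def scalar_prod_def mult.commute intro!: sum.cong)
  show "mat_adjoint V * V = 1\<^sub>m k"
  proof (rule eq_matI)
    fix i j assume ij: "i < dim_row (1\<^sub>m k :: complex mat)" "j < dim_col (1\<^sub>m k :: complex mat)"
    then have "(mat_adjoint V * V) $$ (i, j) = (mat_adjoint V *\<^sub>v col V j) $ i"
      using V by simp
    then show "(mat_adjoint V * V) $$ (i, j) = 1\<^sub>m k $$ (i, j)"
      using ij v inner by (auto simp: col orth)
  qed (use V in auto)
  show "A * V = V * mat_diag k l"
  proof (rule eq_matI)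
    fix a j assume aj: "a < dim_row (V * mat_diag k l)" "j < dim_col (V * mat_diag k l)"
    then have "a < n" "j < k"
      using V by (auto simp: mat_diag_def)
    then have "(A * V) $$ (a, j) = (A *\<^sub>v v j) $ a"
      using V A by (simp add: col)
    also have "\<dots> = (V * mat_diag k l) $$ (a, j)"
      using \<open>a < n\<close> \<open>j < k\<close> v[OF \<open>j < k\<close>] V
      by (simp add: ev mat_diag_mult_right[of _ n] V_def mult.commute)
    finally show "(A * V) $$ (a, j) = (V * mat_diag k l) $$ (a, j)" .
  qed (use V A in \<open>auto simp: mat_diag_def\<close>)
qed

lemma mult_mat_zero_vec: "A \<in> carrier_mat n m \<Longrightarrow> A *\<^sub>v 0\<^sub>v m = (0\<^sub>v n :: complex vec)"
  by (intro eq_vecI) auto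

lemma smult_mat_mult_vec:
  fixes A :: "complex mat"
  assumes "dim_vec x = dim_col A"
  shows "(c \<cdot>\<^sub>m A) *\<^sub>v x = c \<cdot>\<^sub>v (A *\<^sub>v x)"
  using assms by (intro eq_vecI) (auto simp: scalar_prod_def sum_distrib_left mult.assoc)

lemma hermitian_eigenvalue_real:
  fixes A :: "complex mat"
  assumes "A \<in> carrier_mat n n" "mat_adjoint A = A" "x \<in> carrier_vec n" "x \<noteq> 0\<^sub>v n"
    and "A *\<^sub>v x = l \<cdot>\<^sub>v x"
  shows "cnj l = l"
proof -
  have "(A *\<^sub>v x) \<bullet>c x = x \<bullet>c (A *\<^sub>v x)"
    using assms(1-3) by (simp add: scalar_prod_mat_adjoint[of A n n])
  moreover have "(A *\<^sub>v x) \<bullet>c x = l * (x \<bullet>c x)"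
    by (simp add: assms(5))
  moreover have "x \<bullet>c (A *\<^sub>v x) = cnj l * (x \<bullet>c x)"
    by (simp add: assms(5) conjugate_smult_vec)
  ultimately show ?thesis
    using assms(3,4) by simp
qed

text \<open>Fewer than \<open>n\<close> orthonormal eigenvectors of a Hermitian matrix can be extended by one
  more. Restricting \<open>A\<close> to the orthogonal complement would change the dimension; instead the
  eigenvalues on the span of the given vectors are all moved to one number \<open>\<mu>\<close>, by passing to
  \<open>A' = A + V (\<mu> - L) V\<^sup>*\<close>. As \<open>V\<^sup>* A' = \<mu> V\<^sup>*\<close>, an eigenvector of \<open>A'\<close> for an eigenvalue
  different from \<open>\<mu>\<close> is killed by \<open>V\<^sup>*\<close>; so it is orthogonal to the given vectors and an
  eigenvector of \<open>A\<close> itself. Such an eigenvalue exists as soon as \<open>tr A' \<noteq> n \<mu>\<close>, and because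
  \<open>tr A' - n \<mu>\<close> is affine in \<open>\<mu>\<close> with slope \<open>k - n \<noteq> 0\<close>, this excludes only one \<open>\<mu>\<close>.\<close>

lemma hermitian_next_eigenvector:
  fixes A :: "complex mat"
  assumes A: "A \<in> carrier_mat n n" and herm: "mat_adjoint A = A" and k: "k < n"
    and v: "\<And>i. i < k \<Longrightarrow> v i \<in> carrier_vec n"
    and orth: "\<And>i j. i < k \<Longrightarrow> j < k \<Longrightarrow> v i \<bullet>c v j = (if i = j then 1 else 0)"
    and ev: "\<And>i. i < k \<Longrightarrow> A *\<^sub>v v i = complex_of_real (l i) \<cdot>\<^sub>v v i"
  obtains x :: "complex vec" and m :: real
  where "x \<in> carrier_vec n" "x \<bullet>c x = 1" "A *\<^sub>v x = complex_of_real m \<cdot>\<^sub>v x"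
    "\<And>i. i < k \<Longrightarrow> x \<bullet>c v i = 0"
proof -
  define V where "V = Matrix.mat n k (\<lambda>(a, i). v i $ a)"
  \<comment> \<open>The quotient is the only value with \<open>tr A' = n \<mu>\<close>; adding 1 avoids it.\<close>
  define \<mu> where "\<mu> = (mat_trace A - (\<Sum>i<k. complex_of_real (l i))) / (of_nat n - of_nat k) + 1"
  define D where "D = mat_diag k (\<lambda>i. \<mu> - of_real (l i))"
  define L where "L = mat_diag k (\<lambda>i. complex_of_real (l i))"
  have V: "V \<in> carrier_mat n k" and VV: "mat_adjoint V * V = 1\<^sub>m k" and AV: "A * V = V * L"
    and inner: "\<And>x i. x \<in> carrier_vec n \<Longrightarrow> i < k \<Longrightarrow> (mat_adjoint V *\<^sub>v x) $ i = x \<bullet>c v i"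
    unfolding V_def L_def using orthonormal_columns[where A=A and v=v and l="\<lambda>i. of_real (l i)", OF A v orth ev] by auto
  have D: "D \<in> carrier_mat k k" and L: "L \<in> carrier_mat k k"
    by (auto simp: D_def L_def)
  have Vs: "mat_adjoint V \<in> carrier_mat k n"
    using V by simp
  define A' where "A' = A + V * (D * mat_adjoint V)"
  have A': "A' \<in> carrier_mat n n"
    using A V D by (auto simp: A'_def)
  have "mat_trace A' = mat_trace A + mat_trace (D * mat_adjoint V * V)"
    unfolding A'_def using A V D Vs
    by (subst mat_trace_add[of _ n]) (auto simp: mat_trace_comm[of V n k])
  also have "D * mat_adjoint V * V = D"
    using D Vs V by (simp add: assoc_mult_mat[of _ k k _ n _ k] VV)
  also have "mat_trace A + mat_trace D = mat_trace A + of_nat k * \<mu> - (\<Sum>i<k. complex_of_real (l i))"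
    by (simp add: D_def mat_trace_diag sum_subtractf)
  also have "\<dots> \<noteq> of_nat n * \<mu>"
  proof
    assume eq: "mat_trace A + of_nat k * \<mu> - (\<Sum>i<k. complex_of_real (l i)) = of_nat n * \<mu>"
    have "complex_of_nat n - of_nat k \<noteq> 0"
      using k by simp
    then have "\<mu> = (mat_trace A - (\<Sum>i<k. complex_of_real (l i))) / (of_nat n - of_nat k)"
      using eq by (simp add: field_simps)
    then show False
      by (simp add: \<mu>_def)
  qed
  finally obtain m where m: "eigenvalue A' m" "m \<noteq> \<mu>"
    using mat_trace_single_eigenvalue[OF A'] by blast
  then obtain x where x: "x \<in> carrier_vec n" "x \<noteq> 0\<^sub>v n" and A'x: "A' *\<^sub>v x = m \<cdot>\<^sub>v x"
    using A' by (auto simp: eigenvalue_def eigenvector_def)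
  have VA: "mat_adjoint V * A = L * mat_adjoint V"
  proof -
    have "mat_adjoint (A * V) = mat_adjoint (V * L)"
      by (simp add: AV)
    then show ?thesis
      using A V L herm by (simp add: mat_adjoint_mult[of _ n n _ k] mat_adjoint_mult[of _ n k _ k])
        (simp add: L_def)
  qed
  have "mat_adjoint V * A' = L * mat_adjoint V + D * mat_adjoint V"
  proof -
    have "mat_adjoint V * (V * (D * mat_adjoint V)) = D * mat_adjoint V"
      using V Vs D VV by (simp flip: assoc_mult_mat[of _ k n _ k _ n])
    then show ?thesis
      unfolding A'_def using A V D Vs
      by (subst mult_add_distrib_mat[of _ k n _ n]) (auto simp: VA)
  qed
  also have "\<dots> = \<mu> \<cdot>\<^sub>m mat_adjoint V"
    using V unfolding L_def D_def
    by (intro eq_matI) (auto simp: mat_diag_mult_left[of _ k n] algebra_simps)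
  finally have VA': "mat_adjoint V * A' = \<mu> \<cdot>\<^sub>m mat_adjoint V" .
  have "m \<cdot>\<^sub>v (mat_adjoint V *\<^sub>v x) = mat_adjoint V *\<^sub>v (A' *\<^sub>v x)"
    using Vs x by (simp add: A'x mult_mat_vec[of _ k n])
  also have "\<dots> = \<mu> \<cdot>\<^sub>v (mat_adjoint V *\<^sub>v x)"
    using V Vs A' x by (simp add: VA' smult_mat_mult_vec flip: assoc_mult_mat_vec[of _ k n _ n])
  finally have eqv: "m \<cdot>\<^sub>v (mat_adjoint V *\<^sub>v x) = \<mu> \<cdot>\<^sub>v (mat_adjoint V *\<^sub>v x)" .
  have Vx: "(mat_adjoint V *\<^sub>v x) $ i = 0" if "i < k" for i
  proof -
    have "(m \<cdot>\<^sub>v (mat_adjoint V *\<^sub>v x)) $ i = (\<mu> \<cdot>\<^sub>v (mat_adjoint V *\<^sub>v x)) $ i"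
      by (simp only: eqv)
    then show ?thesis
      using V Vs m(2) that by (simp del: index_mult_mat_vec)
  qed
  have Vx0: "mat_adjoint V *\<^sub>v x = 0\<^sub>v k"
    using Vx V Vs by (intro eq_vecI) (auto simp del: index_mult_mat_vec)
  have "A' *\<^sub>v x = A *\<^sub>v x + V *\<^sub>v (D *\<^sub>v (mat_adjoint V *\<^sub>v x))"
    unfolding A'_def using A V D Vs x
    by (simp add: add_mult_distrib_mat_vec[of _ n n] assoc_mult_mat_vec[of _ n k _ n]
        assoc_mult_mat_vec[of _ k k _ n])
  also have "\<dots> = A *\<^sub>v x"
    using A V D x unfolding Vx0
    by (simp add: mult_mat_zero_vec[of _ k k] mult_mat_zero_vec[of _ n k] right_zero_vec[of _ n])
  finally have Ax: "A *\<^sub>v x = m \<cdot>\<^sub>v x"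
    by (simp add: A'x)
  have "cnj m = m"
    by (rule hermitian_eigenvalue_real[OF A herm x Ax])
  then have mr: "complex_of_real (Re m) = m"
    by (simp add: complex_eq_iff)
  define c where "c = complex_of_real (1 / vec_norm2 x)"
  have c: "c * cnj c * (x \<bullet>c x) = 1"
    using x vec_norm2_eq_0_iff[OF x(1)] by (simp add: cscalar_prod_self c_def power2_eq_square)
  show ?thesis
  proof (rule that)
    show "c \<cdot>\<^sub>v x \<in> carrier_vec n"
      using x by simp
    show "(c \<cdot>\<^sub>v x) \<bullet>c (c \<cdot>\<^sub>v x) = 1"
      using x c by (simp add: conjugate_smult_vec mult_ac)
    show "A *\<^sub>v (c \<cdot>\<^sub>v x) = complex_of_real (Re m) \<cdot>\<^sub>v (c \<cdot>\<^sub>v x)"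
      using A x by (simp add: mult_mat_vec Ax mr smult_smult_assoc mult.commute)
    show "(c \<cdot>\<^sub>v x) \<bullet>c v i = 0" if "i < k" for i
      using x v that Vx inner by (simp del: index_mult_mat_vec)
  qed
qed

lemma hermitian_orthonormal_eigenvectors:
  fixes A :: "complex mat"
  assumes A: "A \<in> carrier_mat n n" and herm: "mat_adjoint A = A" and "k \<le> n"
  shows "\<exists>v l. (\<forall>i<k. v i \<in> carrier_vec n \<and> A *\<^sub>v v i = complex_of_real (l i) \<cdot>\<^sub>v v i) \<and>
    (\<forall>i<k. \<forall>j<k. v i \<bullet>c v j = (if i = j then 1 else 0))"
  using \<open>k \<le> n\<close>
proof (induction k)
  case 0
  then show ?case by simp
next
  case (Suc k)
  from Suc.IH[OF Suc_leD[OF Suc.prems]] obtain v l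
    where "\<forall>i<k. v i \<in> carrier_vec n \<and> A *\<^sub>v v i = complex_of_real (l i) \<cdot>\<^sub>v v i"
      and "\<forall>i<k. \<forall>j<k. v i \<bullet>c v j = (if i = j then 1 else 0)"
    by blast
  then have v: "\<And>i. i < k \<Longrightarrow> v i \<in> carrier_vec n"
    and ev: "\<And>i. i < k \<Longrightarrow> A *\<^sub>v v i = complex_of_real (l i) \<cdot>\<^sub>v v i"
    and orth: "\<And>i j. i < k \<Longrightarrow> j < k \<Longrightarrow> v i \<bullet>c v j = (if i = j then 1 else 0)"
    by blast+
  obtain x m where x: "x \<in> carrier_vec n" "x \<bullet>c x = 1" "A *\<^sub>v x = complex_of_real m \<cdot>\<^sub>v x"
    "\<And>i. i < k \<Longrightarrow> x \<bullet>c v i = 0"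
    using hermitian_next_eigenvector[where v=v and l=l, OF A herm Suc_le_lessD[OF Suc.prems]] v orth ev
    by blast
  have x': "v i \<bullet>c x = 0" if "i < k" for i
  proof -
    have "v i \<bullet>c x = cnj (x \<bullet>c v i)"
      using x(1) v[OF that] by (simp add: scalar_prod_def mult.commute)
    then show ?thesis
      using x(4) that by simp
  qed
  show ?case
  proof (intro exI[of _ "v(k := x)"] exI[of _ "l(k := m)"] conjI allI impI)
    fix i j assume "i < Suc k" "j < Suc k"
    then show "(v(k := x)) i \<bullet>c (v(k := x)) j = (if i = j then 1 else 0)"
      using orth[of i j] x(2,4) x' by (cases "i = k"; cases "j = k") simp_all
  next
    fix i assume "i < Suc k"
    then show "(v(k := x)) i \<in> carrier_vec n"
      and "A *\<^sub>v (v(k := x)) i = complex_of_real ((l(k := m)) i) \<cdot>\<^sub>v (v(k := x)) i"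
      using v[of i] ev[of i] x(1,3) by (cases "i = k"; simp)+
  qed
qed

lemma hermitian_spectral_decomposition:
  fixes A :: "complex mat"
  assumes A: "A \<in> carrier_mat n n" and herm: "mat_adjoint A = A"
  obtains U :: "complex mat" and d :: "nat \<Rightarrow> real"
  where "U \<in> carrier_mat n n" "mat_adjoint U * U = 1\<^sub>m n"
    "A = U * mat_diag n (\<lambda>i. of_real (d i)) * mat_adjoint U"
proof -
  obtain v l where vl: "\<And>i. i < n \<Longrightarrow> v i \<in> carrier_vec n"
      "\<And>i j. i < n \<Longrightarrow> j < n \<Longrightarrow> v i \<bullet>c v j = (if i = j then 1 else 0)"
      "\<And>i. i < n \<Longrightarrow> A *\<^sub>v v i = complex_of_real (l i) \<cdot>\<^sub>v v i"
    using hermitian_orthonormal_eigenvectors[OF A herm order_refl] by metis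
  define U where "U = Matrix.mat n n (\<lambda>(a, i). v i $ a)"
  have U: "U \<in> carrier_mat n n" "mat_adjoint U * U = 1\<^sub>m n"
    and AU: "A * U = U * mat_diag n (\<lambda>i. of_real (l i))"
    unfolding U_def using orthonormal_columns(1-3)[where A=A and v=v and l="\<lambda>i. of_real (l i)", OF A vl] by auto
  have "U * mat_diag n (\<lambda>i. of_real (l i)) * mat_adjoint U = A * (U * mat_adjoint U)"
    using A U by (simp add: assoc_mult_mat[of _ n n _ n _ n] flip: AU)
  also have "\<dots> = A"
    using A U unitary_right[OF U] by simp
  finally show ?thesis
    using that U by metis
qed

section \<open>Positive semidefinite square roots and singular values\<close>

lemma mult_unitary_left:
  fixes U :: "complex mat"
  assumes "U \<in> carrier_mat n n" "mat_adjoint U * U = 1\<^sub>m n" "X \<in> carrier_mat n m"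
  shows "mat_adjoint U * (U * X) = X"
  using assms by (simp flip: assoc_mult_mat[of _ n n _ n _ m])

lemma mat_diag_mult_vec:
  assumes "x \<in> carrier_vec n" "i < n"
  shows "(mat_diag n f *\<^sub>v x) $ i = (f i :: complex) * x $ i"
proof -
  have "(mat_diag n f *\<^sub>v x) $ i = (\<Sum>j<n. if j = i then f i * x $ i else 0)"
    using assms by (simp add: mat_diag_def scalar_prod_def lessThan_atLeast0
        if_distrib[where f="\<lambda>y. y * _"] cong: if_cong)
  then show ?thesis
    using assms by simp
qed

text \<open>The map \<open>f \<mapsto> U diag(f) U\<^sup>*\<close> is the functional calculus of a Hermitian matrix that is
  diagonalised by \<open>U\<close>. Through it, products, adjoints, traces and quadratic forms are computed on
  the eigenvalues; square root and pseudoinverse are instances.\<close>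

lemma conj_diag_mult:
  fixes U :: "complex mat"
  assumes "U \<in> carrier_mat n n" "mat_adjoint U * U = 1\<^sub>m n"
  shows "(U * mat_diag n f * mat_adjoint U) * (U * mat_diag n g * mat_adjoint U) =
    U * mat_diag n (\<lambda>i. f i * g i) * mat_adjoint U"
  using assms
  by (simp add: assoc_mult_mat[of _ n n _ n _ n] mult_unitary_left[of U n _ n]
      flip: mat_diag_diag) 

lemma conj_diag_adjoint:
  fixes U :: "complex mat"
  assumes "U \<in> carrier_mat n n"
  shows "mat_adjoint (U * mat_diag n f * mat_adjoint U) = U * mat_diag n (\<lambda>i. cnj (f i)) * mat_adjoint U"
  using assms
  by (simp add: mat_adjoint_mult[of _ n n _ n] assoc_mult_mat[of _ n n _ n _ n])

lemma conj_diag_trace: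
  fixes U :: "complex mat"
  assumes "U \<in> carrier_mat n n" "mat_adjoint U * U = 1\<^sub>m n"
  shows "mat_trace (U * mat_diag n f * mat_adjoint U) = (\<Sum>i<n. f i)"
proof -
  have "mat_trace (U * mat_diag n f * mat_adjoint U) = mat_trace (mat_adjoint U * (U * mat_diag n f))"
    using assms by (intro mat_trace_comm[of _ n n]) auto
  then show ?thesis
    using assms by (simp add: mult_unitary_left[of U n _ n] mat_trace_diag)
qed

lemma conj_diag_scalar_prod:
  fixes U :: "complex mat"
  assumes "U \<in> carrier_mat n n" "x \<in> carrier_vec n"
  shows "((U * mat_diag n f * mat_adjoint U) *\<^sub>v x) \<bullet>c x
    = (\<Sum>i<n. f i * complex_of_real ((cmod ((mat_adjoint U *\<^sub>v x) $ i))\<^sup>2))"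
proof -
  define y where "y = mat_adjoint U *\<^sub>v x"
  have y: "y \<in> carrier_vec n"
    unfolding y_def using assms by (intro mult_mat_vec_carrier[of _ n n]) auto
  have "((U * mat_diag n f * mat_adjoint U) *\<^sub>v x) \<bullet>c x = (U *\<^sub>v (mat_diag n f *\<^sub>v y)) \<bullet>c x"
    unfolding y_def using assms by (simp add: assoc_mult_mat_vec[of _ n n _ n])
  also have "\<dots> = (mat_diag n f *\<^sub>v y) \<bullet>c y"
    using assms y by (subst scalar_prod_mat_adjoint[of U n n]) (auto simp: y_def mat_diag_def)
  also have "\<dots> = (\<Sum>i<n. f i * y $ i * cnj (y $ i))"
    using y by (auto simp: scalar_prod_def[of _ "conjugate y"] lessThan_atLeast0 mat_diag_mult_vec
        simp del: index_mult_mat_vec intro!: sum.cong)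
  finally show ?thesis
    by (simp add: mult.assoc flip: y_def complex_norm_square)
qed

lemma mat_psd_conj_diag:
  assumes "U \<in> carrier_mat n n" "\<And>i. i < n \<Longrightarrow> 0 \<le> d i"
  shows "mat_psd (U * mat_diag n (\<lambda>i. complex_of_real (d i)) * mat_adjoint U)"
  unfolding mat_psd_def
proof (intro conjI ballI)
  fix x :: "complex vec" assume "x \<in> carrier_vec (dim_col (U * mat_diag n (\<lambda>i. complex_of_real (d i)) * mat_adjoint U))"
  then have "x \<in> carrier_vec n"
    using assms by simp
  then show "0 \<le> ((U * mat_diag n (\<lambda>i. complex_of_real (d i)) * mat_adjoint U) *\<^sub>v x) \<bullet>c x"
    using assms by (auto simp: conj_diag_scalar_prod less_eq_complex_def intro!: sum_nonneg)
qed (use assms in \<open>auto simp: conj_diag_adjoint\<close>)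

text \<open>Tests positivity on the \<open>i\<close>-th column of \<open>U\<close>.\<close>

lemma psd_eigenvalue_nonneg:
  assumes U: "U \<in> carrier_mat n n" "mat_adjoint U * U = 1\<^sub>m n"
    and psd: "mat_psd (U * mat_diag n (\<lambda>i. complex_of_real (d i)) * mat_adjoint U)" and i: "i < n"
  shows "0 \<le> d i"
proof -
  define x where "x = U *\<^sub>v unit_vec n i"
  have x: "x \<in> carrier_vec n"
    unfolding x_def using U by (intro mult_mat_vec_carrier[of _ n n]) auto
  have "mat_adjoint U *\<^sub>v x = unit_vec n i"
    using U by (simp add: x_def flip: assoc_mult_mat_vec[of _ n n _ n])
  moreover have "0 \<le> ((U * mat_diag n (\<lambda>i. complex_of_real (d i)) * mat_adjoint U) *\<^sub>v x) \<bullet>c x"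
    using psd U x by (simp add: mat_psd_def)
  ultimately have "0 \<le> (\<Sum>j<n. complex_of_real (d j) * complex_of_real ((cmod (unit_vec n i $ j))\<^sup>2))"
    using U x by (simp add: conj_diag_scalar_prod)
  also have "\<dots> = (\<Sum>j<n. if j = i then complex_of_real (d i) else 0)"
    by (intro sum.cong) (auto simp: unit_vec_def)
  also have "\<dots> = complex_of_real (d i)"
    using i by simp
  finally show ?thesis
    by (simp add: less_eq_complex_def)
qed

lemma psd_spectral_decomposition:
  assumes "R \<in> carrier_mat n n" "mat_psd R"
  obtains U :: "complex mat" and d :: "nat \<Rightarrow> real"
  where "U \<in> carrier_mat n n" "mat_adjoint U * U = 1\<^sub>m n" "\<And>i. i < n \<Longrightarrow> 0 \<le> d i"
    "R = U * mat_diag n (\<lambda>i. of_real (d i)) * mat_adjoint U"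
proof -
  obtain U d where *: "U \<in> carrier_mat n n" "mat_adjoint U * U = 1\<^sub>m n"
    "R = U * mat_diag n (\<lambda>i. of_real (d i)) * mat_adjoint U"
    using hermitian_spectral_decomposition[OF assms(1)] assms(2) unfolding mat_psd_def by metis
  then show ?thesis
    using that psd_eigenvalue_nonneg[of U n d] assms by metis
qed

text \<open>Diagonalise \<open>R\<close> and \<open>S\<close> by \<open>U\<close> and \<open>V\<close>. In terms of \<open>W = U\<^sup>* V\<close>, equality of the
  squares says \<open>d\<^sub>i\<^sup>2 W\<^sub>i\<^sub>j = W\<^sub>i\<^sub>j c\<^sub>j\<^sup>2\<close>. As \<open>d\<^sub>i\<close> and \<open>c\<^sub>j\<close> are nonnegative, \<open>d\<^sub>i = c\<^sub>j\<close>
  whenever \<open>W\<^sub>i\<^sub>j \<noteq> 0\<close>, so the squares can be removed.\<close>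

lemma psd_square_root_unique:
  assumes R: "R \<in> carrier_mat n n" "mat_psd R" and S: "S \<in> carrier_mat n n" "mat_psd S"
    and eq: "R * R = S * S"
  shows "R = S"
proof -
  obtain U d where U: "U \<in> carrier_mat n n" "mat_adjoint U * U = 1\<^sub>m n"
    and d: "\<And>i. i < n \<Longrightarrow> 0 \<le> d i" and R': "R = U * mat_diag n (\<lambda>i. complex_of_real (d i)) * mat_adjoint U"
    using psd_spectral_decomposition[OF R] by metis
  obtain V c where V: "V \<in> carrier_mat n n" "mat_adjoint V * V = 1\<^sub>m n"
    and c: "\<And>i. i < n \<Longrightarrow> 0 \<le> c i" and S': "S = V * mat_diag n (\<lambda>i. complex_of_real (c i)) * mat_adjoint V"
    using psd_spectral_decomposition[OF S] by metis
  define W where "W = mat_adjoint U * V"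
  have W: "W \<in> carrier_mat n n"
    using U V by (auto simp: W_def intro: mult_carrier_mat)
  have conj: "mat_adjoint U * (U * mat_diag n f * mat_adjoint U) * V = mat_diag n f * W" for f
    using U V by (simp add: W_def assoc_mult_mat[of _ n n _ n _ n] mult_unitary_left[of U n _ n])
  have conj': "mat_adjoint U * (V * mat_diag n f * mat_adjoint V) * V = W * mat_diag n f" for f
    using U V by (simp add: W_def assoc_mult_mat[of _ n n _ n _ n] right_mult_one_mat[of _ n n])
  have sq: "mat_diag n (\<lambda>i. complex_of_real (d i) * complex_of_real (d i)) * W
      = W * mat_diag n (\<lambda>i. complex_of_real (c i) * complex_of_real (c i))"
    using eq U V by (simp add: R' S' conj_diag_mult flip: conj conj')
  have "mat_diag n (\<lambda>i. complex_of_real (d i)) * W = W * mat_diag n (\<lambda>i. complex_of_real (c i))"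
  proof (rule eq_matI)
    fix i j assume "i < dim_row (W * mat_diag n (\<lambda>i. complex_of_real (c i)))"
      "j < dim_col (W * mat_diag n (\<lambda>i. complex_of_real (c i)))"
    then have ij: "i < n" "j < n"
      using W by (auto simp: mat_diag_def)
    have "(mat_diag n (\<lambda>i. complex_of_real (d i) * complex_of_real (d i)) * W) $$ (i, j)
        = (W * mat_diag n (\<lambda>i. complex_of_real (c i) * complex_of_real (c i))) $$ (i, j)"
      by (simp only: sq)
    then have "W $$ (i, j) = 0 \<or> complex_of_real (d i * d i) = complex_of_real (c j * c j)"
      using ij W by (simp add: mat_diag_mult_left[of _ n n] mat_diag_mult_right[of _ n n] mult.commute)
    then have "W $$ (i, j) = 0 \<or> (d i)\<^sup>2 = (c j)\<^sup>2"
      by (simp only: of_real_eq_iff power2_eq_square)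
    then have "W $$ (i, j) = 0 \<or> d i = c j"
      using d[OF ij(1)] c[OF ij(2)] by (simp add: power2_eq_iff_nonneg)
    then show "(mat_diag n (\<lambda>i. complex_of_real (d i)) * W) $$ (i, j)
      = (W * mat_diag n (\<lambda>i. complex_of_real (c i))) $$ (i, j)"
      using ij W by (auto simp: mat_diag_mult_left[of _ n n] mat_diag_mult_right[of _ n n])
  qed (use W in \<open>auto simp: mat_diag_def\<close>)
  then have "mat_adjoint U * R * V = mat_adjoint U * S * V"
    by (simp add: R' S' conj conj')
  then have "U * (mat_adjoint U * R * V) * mat_adjoint V = U * (mat_adjoint U * S * V) * mat_adjoint V"
    by simp
  moreover have "U * (mat_adjoint U * X * V) * mat_adjoint V = X" if "X \<in> carrier_mat n n" for X
  proof -
    have "U * (mat_adjoint U * X * V) * mat_adjoint V = (U * mat_adjoint U) * X * (V * mat_adjoint V)"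
      using U V that by (simp add: assoc_mult_mat[of _ n n _ n _ n])
    then show ?thesis
      using that unitary_right[OF U] unitary_right[OF V] by simp
  qed
  ultimately show ?thesis
    using R S by simp
qed

lemma mat_psd_sqrt_eqI:
  assumes "R \<in> carrier_mat n n" "mat_psd R"
  shows "mat_psd_sqrt (R * R) = R"
  unfolding mat_psd_sqrt_def
proof (rule the_equality)
  show "S = R" if "S \<in> carrier_mat (dim_row (R * R)) (dim_col (R * R)) \<and> mat_psd S \<and> S * S = R * R" for S
    using that assms psd_square_root_unique[of S n R] by auto
qed (use assms in auto)

lemma mat_psd_gram:
  fixes M :: "complex mat"
  assumes M: "M \<in> carrier_mat p q"
  shows "mat_psd (mat_adjoint M * M)"
proof -
  have "0 \<le> ((mat_adjoint M * M) *\<^sub>v v) \<bullet>c v" if v: "v \<in> carrier_vec q" for v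
  proof -
    have "((mat_adjoint M * M) *\<^sub>v v) \<bullet>c v = (M *\<^sub>v v) \<bullet>c (M *\<^sub>v v)"
      using M v scalar_prod_mat_adjoint[of "mat_adjoint M" q p "M *\<^sub>v v" v]
      by (simp add: assoc_mult_mat_vec[of _ q p _ q])
    then show ?thesis
      by (simp add: conjugate_square_ge_0_vec)
  qed
  then show ?thesis
    using M by (simp add: mat_psd_def mat_adjoint_mult[of _ q p _ q])
qed

text \<open>The numbers \<open>s\<^sub>i\<close> are the singular values of \<open>M\<close>, and the columns of \<open>U\<close> are right
  singular vectors. All further facts about the trace norm are derived from this description.\<close>

lemma trace_norm_singular_values:
  assumes M: "M \<in> carrier_mat p q"
  obtains U :: "complex mat" and s :: "nat \<Rightarrow> real"
  where "U \<in> carrier_mat q q" "mat_adjoint U * U = 1\<^sub>m q" "\<And>i. i < q \<Longrightarrow> 0 \<le> s i"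
    "mat_adjoint M * M = U * mat_diag q (\<lambda>i. of_real ((s i)\<^sup>2)) * mat_adjoint U"
    "trace_norm M = (\<Sum>i<q. s i)"
proof -
  have "mat_adjoint M * M \<in> carrier_mat q q"
    using M by (auto intro: mult_carrier_mat)
  then obtain U d where U: "U \<in> carrier_mat q q" "mat_adjoint U * U = 1\<^sub>m q"
    and d: "\<And>i. i < q \<Longrightarrow> 0 \<le> d i"
    and MM: "mat_adjoint M * M = U * mat_diag q (\<lambda>i. of_real (d i)) * mat_adjoint U"
    using psd_spectral_decomposition mat_psd_gram[OF M] by metis
  \<comment> \<open>The truncation makes \<open>s\<close> nonnegative at every index, also outside the range of \<open>d\<close>.\<close>
  define s where "s = (\<lambda>i. sqrt (max 0 (d i)))"
  have s: "0 \<le> s i" for i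
    by (simp add: s_def)
  have "mat_diag q (\<lambda>i. complex_of_real (d i)) = mat_diag q (\<lambda>i. of_real ((s i)\<^sup>2))"
    using d by (intro eq_matI) (auto simp: mat_diag_def s_def)
  then have MM': "mat_adjoint M * M = U * mat_diag q (\<lambda>i. of_real ((s i)\<^sup>2)) * mat_adjoint U"
    using MM by simp
  define R where "R = U * mat_diag q (\<lambda>i. complex_of_real (s i)) * mat_adjoint U"
  have R: "R \<in> carrier_mat q q" "mat_psd R"
    using U s by (auto simp: R_def intro: mult_carrier_mat mat_psd_conj_diag)
  have "mat_adjoint M * M = R * R"
    using U by (simp add: MM' R_def conj_diag_mult power2_eq_square)
  then have "trace_norm M = Re (mat_trace R)"
    using R by (simp add: trace_norm_def mat_psd_sqrt_eqI)
  also have "\<dots> = (\<Sum>i<q. s i)"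
    using U by (simp add: R_def conj_diag_trace)
  finally show ?thesis
    using that U s MM' by blast
qed

section \<open>Duality between the trace norm and the operator norm\<close>

text \<open>In the coordinates given by the right singular vectors, \<open>M\<close> multiplies lengths by the
  singular values.\<close>

lemma vec_norm2_gram:
  assumes M: "M \<in> carrier_mat p q" and x: "x \<in> carrier_vec q"
    and U: "U \<in> carrier_mat q q"
    and MM: "mat_adjoint M * M = U * mat_diag q (\<lambda>i. of_real ((s i)\<^sup>2)) * mat_adjoint U"
  shows "(vec_norm2 (M *\<^sub>v x))\<^sup>2 = (\<Sum>i<q. (s i)\<^sup>2 * (cmod ((mat_adjoint U *\<^sub>v x) $ i))\<^sup>2)"
proof -
  have "complex_of_real ((vec_norm2 (M *\<^sub>v x))\<^sup>2) = (M *\<^sub>v x) \<bullet>c (M *\<^sub>v x)"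
    by (simp only: cscalar_prod_self)
  also have "\<dots> = ((mat_adjoint M * M) *\<^sub>v x) \<bullet>c x"
    using M x scalar_prod_mat_adjoint[of "mat_adjoint M" q p "M *\<^sub>v x" x]
    by (simp add: assoc_mult_mat_vec[of _ q p _ q])
  also have "\<dots> = complex_of_real (\<Sum>i<q. (s i)\<^sup>2 * (cmod ((mat_adjoint U *\<^sub>v x) $ i))\<^sup>2)"
    by (simp add: MM conj_diag_scalar_prod[OF U x])
  finally show ?thesis
    by (simp only: of_real_eq_iff)
qed

text \<open>Compute the trace in the basis of right singular vectors \<open>u\<^sub>i\<close>: since
  \<open>\<parallel>M u\<^sub>i\<parallel> = s\<^sub>i\<close>, each diagonal entry \<open>\<langle>K M u\<^sub>i, u\<^sub>i\<rangle>\<close> has modulus at most \<open>c s\<^sub>i\<close>.\<close>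

lemma trace_norm_hoelder:
  assumes M: "M \<in> carrier_mat p q" and K: "K \<in> carrier_mat q p" and b: "mat_bounded c K" and c: "0 \<le> c"
  shows "cmod (mat_trace (K * M)) \<le> c * trace_norm M"
proof -
  obtain U s where U: "U \<in> carrier_mat q q" "mat_adjoint U * U = 1\<^sub>m q" and s: "\<And>i. i < q \<Longrightarrow> 0 \<le> s i"
    and MM: "mat_adjoint M * M = U * mat_diag q (\<lambda>i. of_real ((s i)\<^sup>2)) * mat_adjoint U"
    and tn: "trace_norm M = (\<Sum>i<q. s i)"
    using trace_norm_singular_values[OF M] by metis
  have u: "col U i \<in> carrier_vec q" for i
    using U by auto
  have Uu: "mat_adjoint U *\<^sub>v col U i = unit_vec q i" if "i < q" for i
  proof -
    have "mat_adjoint U *\<^sub>v col U i = col (mat_adjoint U * U) i"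
      using U that by (intro col_mult2[symmetric, of _ q q _ q]) auto
    then show ?thesis
      using U that by simp
  qed
  have Mu: "vec_norm2 (M *\<^sub>v col U i) = s i" if "i < q" for i
  proof -
    have "(vec_norm2 (M *\<^sub>v col U i))\<^sup>2 = (\<Sum>j<q. if j = i then (s i)\<^sup>2 else 0)"
      unfolding vec_norm2_gram[OF M u U(1) MM] Uu[OF that]
      by (intro sum.cong) (auto simp: unit_vec_def)
    also have "\<dots> = (s i)\<^sup>2"
      using that by simp
    finally show ?thesis
      using s[OF that] by (simp add: power2_eq_iff_nonneg)
  qed
  have uu: "vec_norm2 (col U i) = 1" if "i < q" for i
  proof -
    have "vec_norm2 (col U i) = vec_norm2 (mat_adjoint U *\<^sub>v col U i)"
      using U u by (intro vec_norm2_isometry[symmetric, of _ q q]) (auto simp: unitary_right)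
    then show ?thesis
      using that by (simp add: Uu vec_norm2_unit_vec)
  qed
  have KM: "K * M \<in> carrier_mat q q"
    using K M by simp
  have "mat_trace (K * M) = mat_trace (mat_adjoint U * (K * M) * U)"
    using U KM unitary_right[OF U]
    by (subst mat_trace_comm[of _ q q]) (auto simp flip: assoc_mult_mat[of _ q q _ q _ q])
  also have "\<dots> = (\<Sum>i<q. (K *\<^sub>v (M *\<^sub>v col U i)) \<bullet>c col U i)"
  proof -
    have "(mat_adjoint U * (K * M) * U) $$ (i, i) = (K *\<^sub>v (M *\<^sub>v col U i)) \<bullet>c col U i" if "i < q" for i
    proof -
      have "(mat_adjoint U * (K * M) * U) $$ (i, i) = row (mat_adjoint U) i \<bullet> col (K * M * U) i"
        using U KM that by (simp add: assoc_mult_mat[of _ q q _ q _ q] del: index_mult_mat(1))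
         (subst index_mult_mat, auto)
      also have "col (K * M * U) i = K * M *\<^sub>v col U i"
        using U that by (intro col_mult2[OF KM]) auto
      also have "\<dots> = K *\<^sub>v (M *\<^sub>v col U i)"
        by (rule assoc_mult_mat_vec[OF K M u])
      also have "row (mat_adjoint U) i = conjugate (col U i)"
        using U that by (simp add: row_mat_adjoint)
      also have "conjugate (col U i) \<bullet> (K *\<^sub>v (M *\<^sub>v col U i)) = (K *\<^sub>v (M *\<^sub>v col U i)) \<bullet>c col U i"
        using U K M u by (intro conjugate_vec_sprod_comm[symmetric, of _ q]) auto
      finally show ?thesis .
    qed
    then show ?thesis
      using U by (simp add: mat_trace_def)
  qed
  also have "cmod \<dots> \<le> (\<Sum>i<q. c * s i)"
  proof (rule sum_norm_le)
    fix i assume "i \<in> {..<q}"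
    then have i: "i < q" by simp
    have "cmod ((K *\<^sub>v (M *\<^sub>v col U i)) \<bullet>c col U i) \<le> vec_norm2 (K *\<^sub>v (M *\<^sub>v col U i)) * vec_norm2 (col U i)"
      using K M u U by (intro cscalar_prod_cauchy_schwarz[of _ q]) auto
    also have "\<dots> \<le> c * vec_norm2 (M *\<^sub>v col U i)"
      using b K M u U by (simp add: uu i mat_bounded_def)
    finally show "cmod ((K *\<^sub>v (M *\<^sub>v col U i)) \<bullet>c col U i) \<le> c * s i"
      by (simp add: Mu i)
  qed
  finally show ?thesis
    by (simp add: tn sum_distrib_left)
qed

text \<open>Equality in the bound above. With the polar decomposition in mind, the contraction is
  \<open>W = E M\<^sup>*\<close>, where \<open>E\<close> is the pseudoinverse of \<open>\<bar>M\<bar>\<close>. Indeed \<open>W M = E \<bar>M\<bar>\<^sup>2 = \<bar>M\<bar>\<close>. To see that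
  \<open>W\<close> is a contraction it is easier to look at \<open>W\<^sup>* = M E\<close>: the factors \<open>s\<^sub>i\<close> and \<open>s\<^sub>i\<^sup>-\<^sup>1\<close>
  cancel, except that coordinates with \<open>s\<^sub>i = 0\<close> are lost.\<close>

lemma trace_norm_attained:
  assumes M: "M \<in> carrier_mat p q"
  obtains W where "W \<in> carrier_mat q p" "mat_bounded 1 W" "mat_trace (W * M) = of_real (trace_norm M)"
proof -
  obtain U s where U: "U \<in> carrier_mat q q" "mat_adjoint U * U = 1\<^sub>m q" and s: "\<And>i. i < q \<Longrightarrow> 0 \<le> s i"
    and MM: "mat_adjoint M * M = U * mat_diag q (\<lambda>i. of_real ((s i)\<^sup>2)) * mat_adjoint U"
    and tn: "trace_norm M = (\<Sum>i<q. s i)"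
    using trace_norm_singular_values[OF M] by metis
  \<comment> \<open>The convention \<open>inverse 0 = 0\<close> is what makes this a pseudoinverse.\<close>
  define E where "E = U * mat_diag q (\<lambda>i. complex_of_real (inverse (s i))) * mat_adjoint U"
  define W where "W = E * mat_adjoint M"
  have E: "E \<in> carrier_mat q q" "mat_adjoint E = E"
    using U by (auto simp: E_def conj_diag_adjoint)
  have Ms: "mat_adjoint M \<in> carrier_mat q p"
    using M by simp
  have W: "W \<in> carrier_mat q p"
    using E Ms by (simp add: W_def)
  have Ws: "mat_adjoint W = M * E"
    using E M Ms by (simp add: W_def mat_adjoint_mult[of _ q q _ p])
  have "mat_bounded 1 (mat_adjoint W)"
    unfolding mat_bounded_def
  proof
    fix x :: "complex vec" assume "x \<in> carrier_vec (dim_col (mat_adjoint W))"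
    then have x: "x \<in> carrier_vec q"
      using W by simp
    have Us: "mat_adjoint U \<in> carrier_mat q q"
      using U by simp
    have UE: "mat_adjoint U *\<^sub>v (E *\<^sub>v x) = mat_diag q (\<lambda>i. complex_of_real (inverse (s i))) *\<^sub>v (mat_adjoint U *\<^sub>v x)"
    proof -
      have "mat_adjoint U * E = mat_diag q (\<lambda>i. complex_of_real (inverse (s i))) * mat_adjoint U"
        using U by (simp add: E_def assoc_mult_mat[of _ q q _ q _ q] mult_unitary_left[of U q _ q])
      then show ?thesis
        using U E x by (simp flip: assoc_mult_mat_vec[of _ q q _ q])
    qed
    have "(vec_norm2 (mat_adjoint W *\<^sub>v x))\<^sup>2 = (vec_norm2 (M *\<^sub>v (E *\<^sub>v x)))\<^sup>2"
      using M E x by (simp add: Ws assoc_mult_mat_vec[of _ p q _ q])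
    also have "\<dots> = (\<Sum>i<q. (s i)\<^sup>2 * (cmod ((mat_adjoint U *\<^sub>v (E *\<^sub>v x)) $ i))\<^sup>2)"
      using E x by (intro vec_norm2_gram[OF M _ U(1) MM]) auto
    also have "\<dots> = (\<Sum>i<q. (s i)\<^sup>2 * (inverse (s i))\<^sup>2 * (cmod ((mat_adjoint U *\<^sub>v x) $ i))\<^sup>2)"
    proof (intro sum.cong refl)
      fix i assume "i \<in> {..<q}"
      then have "(mat_diag q (\<lambda>i. complex_of_real (inverse (s i))) *\<^sub>v (mat_adjoint U *\<^sub>v x)) $ i
          = complex_of_real (inverse (s i)) * (mat_adjoint U *\<^sub>v x) $ i"
        using mat_diag_mult_vec[of "mat_adjoint U *\<^sub>v x" q] Us x by simp
      then show "(s i)\<^sup>2 * (cmod ((mat_adjoint U *\<^sub>v (E *\<^sub>v x)) $ i))\<^sup>2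
          = (s i)\<^sup>2 * (inverse (s i))\<^sup>2 * (cmod ((mat_adjoint U *\<^sub>v x) $ i))\<^sup>2"
        unfolding UE by (simp only: norm_mult norm_of_real power_mult_distrib power2_abs mult.assoc)
    qed
    also have "\<dots> \<le> (\<Sum>i<q. (cmod ((mat_adjoint U *\<^sub>v x) $ i))\<^sup>2)"
    proof (intro sum_mono)
      fix i
      have "(s i)\<^sup>2 * (inverse (s i))\<^sup>2 \<le> 1"
        by (cases "s i = 0") (simp_all flip: power_mult_distrib)
      then show "(s i)\<^sup>2 * (inverse (s i))\<^sup>2 * (cmod ((mat_adjoint U *\<^sub>v x) $ i))\<^sup>2
        \<le> (cmod ((mat_adjoint U *\<^sub>v x) $ i))\<^sup>2"
        by (rule mult_left_le_one_le[OF zero_le_power2, rotated]) simp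
    qed
    also have "\<dots> = (vec_norm2 (mat_adjoint U *\<^sub>v x))\<^sup>2"
      using U by (simp add: vec_norm2_def sum_nonneg del: index_mult_mat_vec)
    also have "vec_norm2 (mat_adjoint U *\<^sub>v x) = vec_norm2 x"
      using U x by (intro vec_norm2_isometry[of _ q q]) (auto simp: unitary_right)
    finally show "vec_norm2 (mat_adjoint W *\<^sub>v x) \<le> 1 * vec_norm2 x"
      by simp
  qed
  then have "mat_bounded 1 W"
    using mat_bounded_adjoint[of 1 "mat_adjoint W" p q] W by simp
  moreover have "mat_trace (W * M) = of_real (trace_norm M)"
  proof -
    have "W * M = E * (mat_adjoint M * M)"
      using E Ms M by (simp add: W_def assoc_mult_mat[of _ q q _ p _ q])
    also have "\<dots> = U * mat_diag q (\<lambda>i. complex_of_real (inverse (s i)) * of_real ((s i)\<^sup>2)) * mat_adjoint U"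
      unfolding MM E_def by (rule conj_diag_mult[OF U])
    finally have "mat_trace (W * M) = (\<Sum>i<q. complex_of_real (inverse (s i)) * of_real ((s i)\<^sup>2))"
      using conj_diag_trace[OF U] by simp
    also have "\<dots> = of_real (trace_norm M)"
      unfolding tn of_real_sum
    proof (intro sum.cong refl)
      show "complex_of_real (inverse (s i)) * of_real ((s i)\<^sup>2) = of_real (s i)" for i
        by (cases "s i = 0") (simp_all add: power2_eq_square)
    qed
    finally show ?thesis .
  qed
  ultimately show ?thesis
    using that W by blast
qed

lemma trace_norm_nonneg: "0 \<le> trace_norm M"
proof -
  have M: "M \<in> carrier_mat (dim_row M) (dim_col M)"
    by simp
  show ?thesis
    by (rule trace_norm_singular_values[OF M]) (auto intro: sum_nonneg)
qed

lemma cmod_mat_trace_le_trace_norm: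
  assumes "M \<in> carrier_mat n n"
  shows "cmod (mat_trace M) \<le> trace_norm M"
  using trace_norm_hoelder[OF assms one_carrier_mat mat_bounded_one] assms by simp

text \<open>Triangle inequality and ideal property in one step: choose a contraction \<open>W\<close> that attains
  the trace norm of \<open>A Y - X B\<close>, move \<open>W\<close> next to \<open>Y\<close> and \<open>X\<close> by cyclicity of the trace, and bound
  \<open>tr ((Y W) A)\<close> and \<open>tr ((W X) B)\<close> separately.\<close>

lemma trace_norm_diff_products:
  assumes A: "A \<in> carrier_mat p q" and Y: "Y \<in> carrier_mat q p"
    and X: "X \<in> carrier_mat p q" and B: "B \<in> carrier_mat q p"
    and bX: "mat_bounded c X" and bY: "mat_bounded c Y" and c: "0 \<le> c"
  shows "trace_norm (A * Y - X * B) \<le> (trace_norm A + trace_norm B) * c"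
proof -
  have AY: "A * Y \<in> carrier_mat p p" and XB: "X * B \<in> carrier_mat p p"
    using A Y X B by auto
  obtain W where W: "W \<in> carrier_mat p p" "mat_bounded 1 W"
    and tr: "mat_trace (W * (A * Y - X * B)) = of_real (trace_norm (A * Y - X * B))"
    using trace_norm_attained[OF minus_carrier_mat[OF XB]] by blast
  have YW: "Y * W \<in> carrier_mat q p" and WX: "W * X \<in> carrier_mat p q"
    using W X Y by auto
  have "mat_trace (W * (A * Y - X * B)) = mat_trace (W * (A * Y)) - mat_trace (W * (X * B))"
    using W AY XB by (simp add: mult_minus_distrib_mat[of _ p p _ p] mat_trace_diff[of _ p])
  also have "mat_trace (W * (A * Y)) = mat_trace (Y * W * A)"
  proof -
    have "mat_trace (W * (A * Y)) = mat_trace ((W * A) * Y)"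
      using W A Y by (simp add: assoc_mult_mat[of _ p p _ q _ p])
    also have "\<dots> = mat_trace (Y * (W * A))"
      by (rule mat_trace_comm[of _ p q]) (use W A Y in auto)
    finally show ?thesis
      using W A Y by (simp add: assoc_mult_mat[of _ q p _ p _ q])
  qed
  also have "W * (X * B) = W * X * B"
    using W X B by (simp add: assoc_mult_mat[of _ p p _ q _ p])
  finally have "trace_norm (A * Y - X * B) = cmod (mat_trace (Y * W * A) - mat_trace (W * X * B))"
    by (metis tr norm_of_real abs_of_nonneg trace_norm_nonneg)
  also have "\<dots> \<le> cmod (mat_trace (Y * W * A)) + cmod (mat_trace (W * X * B))"
    by (rule norm_triangle_ineq4)
  also have "\<dots> \<le> c * trace_norm A + c * trace_norm B"
    using mat_bounded_mult[OF bY W(2) Y W(1) c] mat_bounded_mult[OF W(2) bX W(1) X] c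
    by (intro add_mono trace_norm_hoelder[OF A YW] trace_norm_hoelder[OF B WX]) simp_all
  finally show ?thesis
    by (simp add: algebra_simps)
qed

lemma mat_bounded_entry:
  assumes "mat_bounded c M" "M \<in> carrier_mat p q" "i < p" "j < q"
  shows "cmod (M $$ (i, j)) \<le> c"
proof -
  have "conjugate (unit_vec p i) = (unit_vec p i :: complex vec)"
    by (intro eq_vecI) (auto simp: unit_vec_def)
  then have "M $$ (i, j) = (M *\<^sub>v unit_vec q j) \<bullet>c unit_vec p i"
    using assms by simp
  also have "cmod \<dots> \<le> vec_norm2 (M *\<^sub>v unit_vec q j) * vec_norm2 (unit_vec p i)"
    using assms by (intro cscalar_prod_cauchy_schwarz[of _ p]) auto
  also have "\<dots> \<le> c"
    using assms(1)[unfolded mat_bounded_def, rule_format, of "unit_vec q j"] assms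
    by (simp add: vec_norm2_unit_vec)
  finally show ?thesis .
qed

lemma cmod_mat_trace_le_bound:
  assumes "mat_bounded c M" "M \<in> carrier_mat n n"
  shows "cmod (mat_trace M) \<le> of_nat n * c"
proof -
  have "mat_trace M = (\<Sum>i<n. M $$ (i, i))"
    using assms by (simp add: mat_trace_def)
  also have "cmod \<dots> \<le> (\<Sum>i<n. c)"
    using assms by (intro sum_norm_le) (auto intro: mat_bounded_entry[of c M n n])
  finally show ?thesis
    by simp
qed

text \<open>The trace norm is the trace of a product \<open>W M\<close> with a contraction \<open>W\<close>, hence also of
  \<open>M W\<close>. These square matrices have sizes \<open>q\<close> and \<open>p\<close> and diagonal entries of modulus at most
  \<open>c\<close>.\<close>

lemma trace_norm_le_bound:
  assumes M: "M \<in> carrier_mat p q" and b: "mat_bounded c M" and c: "0 \<le> c"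
  shows "trace_norm M \<le> of_nat p * c" and "trace_norm M \<le> of_nat q * c"
proof -
  obtain W where W: "W \<in> carrier_mat q p" "mat_bounded 1 W"
    and tr: "mat_trace (W * M) = of_real (trace_norm M)"
    using trace_norm_attained[OF M] .
  have tn: "trace_norm M = cmod (mat_trace (W * M))"
    using trace_norm_nonneg[of M] by (simp add: tr)
  show "trace_norm M \<le> of_nat q * c"
    unfolding tn using mat_bounded_mult[OF W(2) b W(1) M] W M
    by (intro cmod_mat_trace_le_bound) auto
  have "mat_trace (W * M) = mat_trace (M * W)"
    by (rule mat_trace_comm[OF W(1) M])
  then show "trace_norm M \<le> of_nat p * c"
    unfolding tn using mat_bounded_mult[OF b W(2) M W(1) c] W M
    by (auto intro!: cmod_mat_trace_le_bound)
qed

text \<open>The supremum that defines the operator norm is over a bounded set, because the norm of an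
  image of a unit vector is at most the sum of the norms of the rows.\<close>

lemma
  shows mat_opnorm_nonneg: "0 \<le> mat_opnorm M"
    and mat_bounded_opnorm: "mat_bounded (mat_opnorm M) M"
proof -
  let ?S = "{v \<in> carrier_vec (dim_col M). vec_norm2 v \<le> 1}"
  have bdd: "bdd_above ((\<lambda>v. vec_norm2 (M *\<^sub>v v)) ` ?S)"
  proof (rule bdd_aboveI2)
    fix v assume "v \<in> ?S"
    then have v: "v \<in> carrier_vec (dim_col M)" "vec_norm2 v \<le> 1"
      by auto
    have "vec_norm2 (M *\<^sub>v v) \<le> (\<Sum>i<dim_row M. cmod ((M *\<^sub>v v) $ i))"
      using L2_set_le_sum[of "{..<dim_row M}" "\<lambda>i. cmod ((M *\<^sub>v v) $ i)"]
      by (simp add: vec_norm2_def L2_set_def)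
    also have "\<dots> \<le> (\<Sum>i<dim_row M. vec_norm2 (conjugate (row M i)))"
    proof (intro sum_mono)
      fix i assume "i \<in> {..<dim_row M}"
      then have "(M *\<^sub>v v) $ i = v \<bullet>c conjugate (row M i)"
        using v by (simp add: comm_scalar_prod[of _ "dim_col M"])
      then have "cmod ((M *\<^sub>v v) $ i) \<le> vec_norm2 v * vec_norm2 (conjugate (row M i))"
        using v by (simp only:) (rule cscalar_prod_cauchy_schwarz[of _ "dim_col M"], auto)
      also have "\<dots> \<le> 1 * vec_norm2 (conjugate (row M i))"
        using v by (intro mult_right_mono) auto
      finally show "cmod ((M *\<^sub>v v) $ i) \<le> vec_norm2 (conjugate (row M i))"
        by simp
    qed
    finally show "vec_norm2 (M *\<^sub>v v) \<le> (\<Sum>i<dim_row M. vec_norm2 (conjugate (row M i)))" .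
  qed
  have le: "vec_norm2 (M *\<^sub>v v) \<le> mat_opnorm M" if "v \<in> ?S" for v
    unfolding mat_opnorm_def by (rule cSUP_upper[OF that bdd])
  have "vec_norm2 (0\<^sub>v (dim_col M)) \<le> 1"
    by (simp add: vec_norm2_def)
  then have "vec_norm2 (M *\<^sub>v 0\<^sub>v (dim_col M)) \<le> mat_opnorm M"
    by (intro le) simp
  then show "0 \<le> mat_opnorm M"
    using vec_norm2_nonneg order_trans by blast
  show "mat_bounded (mat_opnorm M) M"
    unfolding mat_bounded_def
  proof
    fix v :: "complex vec" assume v: "v \<in> carrier_vec (dim_col M)"
    show "vec_norm2 (M *\<^sub>v v) \<le> mat_opnorm M * vec_norm2 v"
    proof (cases "vec_norm2 v = 0")
      case True
      then have "v = 0\<^sub>v (dim_col M)"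
        using v vec_norm2_eq_0_iff by blast
      then have "M *\<^sub>v v = 0\<^sub>v (dim_row M)"
        by (intro eq_vecI) auto
      then show ?thesis
        using True by (simp add: vec_norm2_def)
    next
      case False
      define c where "c = complex_of_real (inverse (vec_norm2 v))"
      have c: "cmod c = inverse (vec_norm2 v)"
        unfolding c_def by (simp only: norm_of_real) simp
      have "cmod c * vec_norm2 (M *\<^sub>v v) = vec_norm2 (M *\<^sub>v (c \<cdot>\<^sub>v v))"
        using v by (simp add: mult_mat_vec[of _ "dim_row M" "dim_col M"] vec_norm2_smult)
      also have "\<dots> \<le> mat_opnorm M"
        using v False by (intro le) (auto simp: vec_norm2_smult c)
      finally show ?thesis
        using False vec_norm2_nonneg[of v] by (simp add: c field_simps less_le)
    qed
  qed
qed

section \<open>Inner products and orthonormal families\<close>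

lemma cinner_zero_right [simp]: "cinner x (0 :: 'a::complex_hilbert_space) = 0"
  using cinner_add_right[of x 0 0] by simp

lemma cinner_add_left: "cinner (x + y) z = cinner x z + cinner (y :: 'a::complex_hilbert_space) z"
  using cinner_add_right[of z x y] by (subst (1 2 3) cinner_commute) simp

lemma cinner_scaleC_left: "cinner (c *\<^sub>C x) (y :: 'a::complex_hilbert_space) = cnj c * cinner x y"
  using cinner_scaleC_right[of y c x] by (subst (1 2) cinner_commute) simp

lemma cinner_zero_left [simp]: "cinner (0 :: 'a::complex_hilbert_space) x = 0"
  by (subst cinner_commute) simp

lemma cinner_diff_right: "cinner x (y - z) = cinner x y - cinner x (z :: 'a::complex_hilbert_space)"
  using cinner_add_right[of x "y - z" z] by simp

lemma cinner_sum_right: "cinner x (\<Sum>i\<in>I. f i :: 'a::complex_hilbert_space) = (\<Sum>i\<in>I. cinner x (f i))"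
  by (induction I rule: infinite_finite_induct) (simp_all add: cinner_add_right)

lemma cinner_sum_left: "cinner (\<Sum>i\<in>I. f i :: 'a::complex_hilbert_space) x = (\<Sum>i\<in>I. cinner (f i) x)"
  by (induction I rule: infinite_finite_induct) (simp_all add: cinner_add_left)

lemma norm_scaleC: "norm (c *\<^sub>C x :: 'a::complex_hilbert_space) = cmod c * norm x"
proof -
  have "complex_of_real ((norm (c *\<^sub>C x))\<^sup>2) = cnj c * c * complex_of_real ((norm x)\<^sup>2)"
    by (simp only: cinner_self[symmetric] cinner_scaleC_left cinner_scaleC_right mult_ac)
  also have "\<dots> = complex_of_real ((cmod c * norm x)\<^sup>2)"
    unfolding power_mult_distrib of_real_mult complex_norm_square by (simp add: mult_ac)
  finally show ?thesis
    unfolding of_real_eq_iff by (rule power2_eq_imp_eq) simp_all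
qed

lemma norm_pythagoras:
  fixes x y :: "'a::complex_hilbert_space"
  assumes "cinner x y = 0"
  shows "(norm (x + y))\<^sup>2 = (norm x)\<^sup>2 + (norm y)\<^sup>2"
proof -
  have "cinner y x = 0"
    using assms by (subst cinner_commute) simp
  then have "complex_of_real ((norm (x + y))\<^sup>2) = complex_of_real ((norm x)\<^sup>2 + (norm y)\<^sup>2)"
    using assms by (simp only: of_real_add cinner_self[symmetric] cinner_add_left cinner_add_right) simp
  then show ?thesis
    by (simp only: of_real_eq_iff)
qed

text \<open>Cauchy--Schwarz: \<open>c x\<close> is the projection of \<open>y\<close> onto the line through \<open>x\<close>, and
  Pythagoras gives \<open>\<parallel>c x\<parallel> \<le> \<parallel>y\<parallel>\<close>.\<close>

lemma cmod_cinner_le: "cmod (cinner x y) \<le> norm x * norm (y :: 'a::complex_hilbert_space)"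
proof (cases "x = 0")
  case False
  define c where "c = cinner x y / of_real ((norm x)\<^sup>2)"
  have "cinner x (y - c *\<^sub>C x) = 0"
    using False by (simp add: cinner_diff_right cinner_scaleC_right cinner_self c_def)
  then have "cinner (c *\<^sub>C x) (y - c *\<^sub>C x) = 0"
    by (simp add: cinner_scaleC_left)
  from norm_pythagoras[OF this] have "(norm (c *\<^sub>C x))\<^sup>2 \<le> (norm y)\<^sup>2"
    by simp
  then have "norm (c *\<^sub>C x) \<le> norm y"
    by (rule power2_le_imp_le) simp
  moreover have "cmod c = cmod (cinner x y) / (norm x)\<^sup>2"
    unfolding c_def norm_divide norm_of_real by simp
  ultimately show ?thesis
    using False by (simp add: norm_scaleC field_simps power2_eq_square)
qed simp

lemma bounded_linear_cinner: "bounded_linear (cinner (x :: 'a::complex_hilbert_space))"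
proof (rule bounded_linear_intro[where K = "norm x"])
  show "norm (cinner x y) \<le> norm y * norm x" for y
    using cmod_cinner_le[of x y] by (simp add: mult.commute)
qed (simp_all add: cinner_add_right scaleR_scaleC cinner_scaleC_right scaleR_conv_of_real)

lemma bounded_clinear_sum:
  "bounded_clinear S \<Longrightarrow> S (\<Sum>i\<in>I. c i *\<^sub>C x i) = (\<Sum>i\<in>I. c i *\<^sub>C S (x i))"
  by (simp add: bounded_clinear_def linear_sum[OF bounded_linear.linear])

lemma bounded_clinear_commutator:
  assumes "bounded_clinear C" "bounded_clinear Z"
  shows "bounded_clinear (\<lambda>x. C (Z x) - Z (C x))"
proof -
  have "bounded_linear (\<lambda>x. C (Z x) - Z (C x))"
    using assms bounded_linear_sub[OF bounded_linear_compose[of C Z] bounded_linear_compose[of Z C]]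
    by (simp add: bounded_clinear_def)
  then show ?thesis
    using assms by (simp add: bounded_clinear_def complex_vector.scale_right_diff_distrib)
qed

definition orthonormal :: "(nat \<Rightarrow> 'a::complex_hilbert_space) \<Rightarrow> bool" where
  "orthonormal f \<longleftrightarrow> (\<forall>i j. cinner (f i) (f j) = (if i = j then 1 else 0))"

lemma orthonormal_basis_iff:
  "orthonormal_basis f \<longleftrightarrow> orthonormal f \<and> closure (complex_vector.span (range f)) = UNIV"
  by (simp add: orthonormal_basis_def orthonormal_def)

lemma cinner_orthonormal_sum:
  assumes "orthonormal f" "finite I" "i \<in> I"
  shows "cinner (f i) (\<Sum>j\<in>I. c j *\<^sub>C f j) = c i"
proof -
  have "cinner (f i) (\<Sum>j\<in>I. c j *\<^sub>C f j) = (\<Sum>j\<in>I. if i = j then c j else 0)"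
    unfolding cinner_sum_right cinner_scaleC_right
    using assms(1) by (intro sum.cong) (auto simp: orthonormal_def)
  then show ?thesis
    using assms by simp
qed

lemma norm_orthonormal_sum:
  assumes "orthonormal f" "finite I"
  shows "(norm (\<Sum>j\<in>I. c j *\<^sub>C f j))\<^sup>2 = (\<Sum>j\<in>I. (cmod (c j))\<^sup>2)"
proof -
  have "complex_of_real ((norm (\<Sum>j\<in>I. c j *\<^sub>C f j))\<^sup>2)
      = (\<Sum>i\<in>I. cnj (c i) * cinner (f i) (\<Sum>j\<in>I. c j *\<^sub>C f j))"
    by (simp only: cinner_self[symmetric] cinner_sum_left cinner_scaleC_left)
  also have "\<dots> = (\<Sum>i\<in>I. c i * cnj (c i))"
    using assms by (intro sum.cong) (auto simp: cinner_orthonormal_sum)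
  finally have "complex_of_real ((norm (\<Sum>j\<in>I. c j *\<^sub>C f j))\<^sup>2) = complex_of_real (\<Sum>j\<in>I. (cmod (c j))\<^sup>2)"
    by (simp only: complex_norm_square of_real_sum)
  then show ?thesis
    by (simp only: of_real_eq_iff)
qed

lemma cinner_span_residual:
  assumes "orthonormal f" "finite I" "v \<in> complex_vector.span (f ` I)"
  shows "cinner v (x - (\<Sum>j\<in>I. cinner (f j) x *\<^sub>C f j)) = 0"
proof -
  let ?K = "{v. cinner v (x - (\<Sum>j\<in>I. cinner (f j) x *\<^sub>C f j)) = 0}"
  have "complex_vector.subspace ?K"
    by (rule complex_vector.subspaceI) (auto simp: cinner_add_left cinner_scaleC_left)
  moreover have "f ` I \<subseteq> ?K"
    using cinner_orthonormal_sum[OF assms(1,2), where c = "\<lambda>j. cinner (f j) x"]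
    by (auto simp: cinner_diff_right)
  ultimately show ?thesis
    using complex_vector.span_minimal[of "f ` I" ?K] assms(3) by blast
qed

lemma orthonormal_sum_in_span:
  "(\<Sum>j\<in>I. c j *\<^sub>C f j) \<in> complex_vector.span (f ` I)"
  by (intro complex_vector.span_sum complex_vector.span_scale complex_vector.span_base imageI)

lemma orth_proj_span:
  assumes f: "orthonormal f" "finite I"
  shows "orth_proj (complex_vector.span (f ` I)) x = (\<Sum>j\<in>I. cinner (f j) x *\<^sub>C f j)"
  unfolding orth_proj_def
proof (rule the_equality)
  let ?p = "\<Sum>j\<in>I. cinner (f j) x *\<^sub>C f j"
  show "?p \<in> complex_vector.span (f ` I) \<and> (\<forall>v\<in>complex_vector.span (f ` I). cinner v (x - ?p) = 0)"
    by (intro conjI ballI cinner_span_residual[OF f] orthonormal_sum_in_span)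
  fix y assume y: "y \<in> complex_vector.span (f ` I) \<and> (\<forall>v\<in>complex_vector.span (f ` I). cinner v (x - y) = 0)"
  define w where "w = y - ?p"
  have w: "w \<in> complex_vector.span (f ` I)"
    unfolding w_def using y by (intro complex_vector.span_diff orthonormal_sum_in_span) simp
  have "cinner w w = cinner w (x - ?p) - cinner w (x - y)"
    by (simp add: w_def flip: cinner_diff_right)
  also have "\<dots> = 0"
    using cinner_span_residual[OF f w] y w by simp
  finally have "w = 0"
    by (simp add: cinner_self)
  then show "y = ?p"
    by (simp add: w_def)
qed

lemma bessel_inequality:
  assumes "orthonormal f" "finite I"
  shows "(\<Sum>j\<in>I. (cmod (cinner (f j) x))\<^sup>2) \<le> (norm x)\<^sup>2"
proof -
  let ?p = "\<Sum>j\<in>I. cinner (f j) x *\<^sub>C f j"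
  have "(norm (?p + (x - ?p)))\<^sup>2 = (norm ?p)\<^sup>2 + (norm (x - ?p))\<^sup>2"
    by (rule norm_pythagoras) (rule cinner_span_residual[OF assms orthonormal_sum_in_span])
  then show ?thesis
    by (simp add: norm_orthonormal_sum[OF assms])
qed

lemma orthonormal_best_approximation:
  assumes "orthonormal f" "finite I" "y \<in> complex_vector.span (f ` I)"
  shows "norm (x - (\<Sum>j\<in>I. cinner (f j) x *\<^sub>C f j)) \<le> norm (x - y)"
proof -
  let ?p = "\<Sum>j\<in>I. cinner (f j) x *\<^sub>C f j"
  have "?p - y \<in> complex_vector.span (f ` I)"
    by (intro complex_vector.span_diff orthonormal_sum_in_span assms(3))
  then have "(norm ((?p - y) + (x - ?p)))\<^sup>2 = (norm (?p - y))\<^sup>2 + (norm (x - ?p))\<^sup>2"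
    by (intro norm_pythagoras cinner_span_residual assms)
  then have "(norm (x - ?p))\<^sup>2 \<le> (norm (x - y))\<^sup>2"
    by simp
  then show ?thesis
    by (rule power2_le_imp_le) simp
qed

lemma span_range_finite:
  assumes "y \<in> complex_vector.span (range f)"
  obtains n :: nat where "y \<in> complex_vector.span (f ` {..<n})"
proof -
  let ?K = "\<Union>n. complex_vector.span (f ` {..<n})"
  have mono: "complex_vector.span (f ` {..<m}) \<subseteq> complex_vector.span (f ` {..<n})" if "m \<le> n" for m n :: nat
    using that by (intro complex_vector.span_mono image_mono) auto
  have "complex_vector.subspace ?K"
  proof (rule complex_vector.subspaceI)
    show "0 \<in> ?K"
      by (auto intro: complex_vector.span_zero)
    show "c *\<^sub>C x \<in> ?K" if "x \<in> ?K" for c x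
      using that by (auto intro: complex_vector.span_scale)
    fix x y assume "x \<in> ?K" "y \<in> ?K"
    then obtain m n where "x \<in> complex_vector.span (f ` {..<m})" "y \<in> complex_vector.span (f ` {..<n})"
      by auto
    then have "x + y \<in> complex_vector.span (f ` {..<max m n})"
      using mono[of m "max m n"] mono[of n "max m n"] by (intro complex_vector.span_add) auto
    then show "x + y \<in> ?K"
      by blast
  qed
  moreover have "range f \<subseteq> ?K"
    by (auto intro!: exI[of _ "Suc _"] complex_vector.span_base)
  ultimately have "y \<in> ?K"
    using complex_vector.span_minimal[of "range f" ?K] assms by blast
  then show ?thesis
    using that by blast
qed

text \<open>The partial sum of order \<open>n\<close> is the best approximation to \<open>x\<close> from the span of the first
  \<open>n\<close> vectors, and by density that distance tends to \<open>0\<close>.\<close>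

lemma orthonormal_basis_expansion:
  assumes "orthonormal_basis f"
  shows "(\<lambda>j. cinner (f j) x *\<^sub>C f j) sums x"
  unfolding sums_def
proof (rule LIMSEQ_I)
  have f: "orthonormal f" and cl: "closure (complex_vector.span (range f)) = UNIV"
    using assms by (auto simp: orthonormal_basis_iff)
  fix r :: real assume "0 < r"
  moreover have "x \<in> closure (complex_vector.span (range f))"
    using cl by simp
  ultimately obtain y where y: "y \<in> complex_vector.span (range f)" "dist y x < r"
    unfolding closure_approachable by blast
  obtain m where m: "y \<in> complex_vector.span (f ` {..<m})"
    using span_range_finite[OF y(1)] .
  show "\<exists>no. \<forall>n\<ge>no. norm ((\<Sum>j<n. cinner (f j) x *\<^sub>C f j) - x) < r"
  proof (intro exI allI impI)
    fix n assume "m \<le> n"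
    then have "y \<in> complex_vector.span (f ` {..<n})"
      using m complex_vector.span_mono[OF image_mono[of "{..<m}" "{..<n}" f]] by auto
    then have "norm (x - (\<Sum>j<n. cinner (f j) x *\<^sub>C f j)) \<le> norm (x - y)"
      using f by (intro orthonormal_best_approximation) auto
    then show "norm ((\<Sum>j<n. cinner (f j) x *\<^sub>C f j) - x) < r"
      using y(2) by (simp add: dist_norm norm_minus_commute)
  qed
qed

text \<open>Matrix multiplication for operators: with \<open>x = e\<^sub>l\<close> and \<open>y = R e\<^sub>m\<close> this expresses an
  entry of \<open>S R\<close> through those of \<open>S\<close> and \<open>R\<close>. It follows from the expansion of \<open>y\<close> because
  \<open>S\<close> is continuous and linear.\<close>

lemma sums_operator_coefficients:
  assumes "orthonormal_basis f" "bounded_clinear S"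
  shows "(\<lambda>j. cinner x (S (f j)) * cinner (f j) y) sums cinner x (S y)"
proof -
  have "bounded_linear (\<lambda>y. cinner x (S y))"
    using assms(2) bounded_linear_compose[OF bounded_linear_cinner] by (auto simp: bounded_clinear_def)
  from bounded_linear.sums[OF this orthonormal_basis_expansion[OF assms(1)]]
  show ?thesis
    using assms(2) by (simp add: bounded_clinear_def cinner_scaleC_right mult.commute)
qed

lemma parseval:
  assumes "orthonormal_basis f"
  shows "(\<lambda>j. cinner x (f j) * cinner (f j) y) sums cinner x y"
  using sums_operator_coefficients[OF assms, of "\<lambda>x. x"]
  by (simp add: bounded_clinear_def bounded_linear_ident)

section \<open>Traces of finite rank compressions\<close>

text \<open>In an arbitrary orthonormal basis \<open>f\<close>, the diagonal entries of \<open>Q T Q\<close> are finite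
  combinations of the products \<open>\<langle>e\<^sub>m, f\<^sub>j\<rangle> \<langle>f\<^sub>j, e\<^sub>l\<rangle>\<close>, whose sums over \<open>j\<close> are known from
  Parseval. The result is the same for all \<open>f\<close>, so it is the trace.\<close>

lemma op_trace_compression:
  assumes e: "orthonormal_basis e" and T: "bounded_clinear T" and I: "finite I"
  defines "Q \<equiv> orth_proj (complex_vector.span (e ` I))"
  shows "op_trace (Q \<circ> T \<circ> Q) = (\<Sum>l\<in>I. cinner (e l) (T (e l)))"
proof -
  have on: "orthonormal e"
    using e by (simp add: orthonormal_basis_iff)
  have Q: "Q x = (\<Sum>j\<in>I. cinner (e j) x *\<^sub>C e j)" for x
    unfolding Q_def by (rule orth_proj_span[OF on I])
  have sums: "(\<lambda>j. cinner (f j) ((Q \<circ> T \<circ> Q) (f j))) sums (\<Sum>l\<in>I. cinner (e l) (T (e l)))"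
    if f: "orthonormal_basis f" for f
  proof -
    have "cinner (f j) ((Q \<circ> T \<circ> Q) (f j))
        = (\<Sum>l\<in>I. \<Sum>m\<in>I. cinner (e l) (T (e m)) * (cinner (e m) (f j) * cinner (f j) (e l)))" for j
      by (simp add: Q bounded_clinear_sum[OF T] cinner_sum_right cinner_scaleC_right
          sum_distrib_left mult_ac)
    moreover have "(\<lambda>j. \<Sum>l\<in>I. \<Sum>m\<in>I. cinner (e l) (T (e m)) * (cinner (e m) (f j) * cinner (f j) (e l)))
        sums (\<Sum>l\<in>I. \<Sum>m\<in>I. cinner (e l) (T (e m)) * cinner (e m) (e l))"
      by (intro sums_sum sums_mult parseval f)
    moreover have "(\<Sum>l\<in>I. \<Sum>m\<in>I. cinner (e l) (T (e m)) * cinner (e m) (e l))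
        = (\<Sum>l\<in>I. \<Sum>m\<in>I. if m = l then cinner (e l) (T (e l)) else 0)"
      using on by (intro sum.cong) (auto simp: orthonormal_def)
    ultimately show ?thesis
      using I by simp
  qed
  show ?thesis
    unfolding op_trace_def
  proof (rule the_equality)
    show "\<forall>f. orthonormal_basis f \<longrightarrow>
        (\<lambda>j. cinner (f j) ((Q \<circ> T \<circ> Q) (f j))) sums (\<Sum>l\<in>I. cinner (e l) (T (e l)))"
      using sums by blast
    show "t = (\<Sum>l\<in>I. cinner (e l) (T (e l)))"
      if "\<forall>f. orthonormal_basis f \<longrightarrow> (\<lambda>j. cinner (f j) ((Q \<circ> T \<circ> Q) (f j))) sums t" for t
      using that sums[OF e] e sums_unique2 by blast
  qed
qed

section \<open>Block matrices of operators\<close>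

lemma block_start_Suc: "block_start k (Suc n) = block_start k n + k n"
  by (simp add: block_start_def)

lemma block_start_mono: "m \<le> n \<Longrightarrow> block_start k m \<le> block_start k n"
  unfolding block_start_def by (intro sum_mono2) auto

text \<open>Since all blocks are nonempty, the block starts are unbounded.\<close>

lemma block_of_index:
  assumes "\<And>n. k n > 0"
  obtains i where "block_start k i \<le> j" "j < block_start k (Suc i)"
proof -
  have "n \<le> block_start k n" for n
  proof (induction n)
    case (Suc n)
    then show ?case
      using assms[of n] by (simp add: block_start_Suc)
  qed simp
  then have "j < block_start k (Suc j)"
    using Suc_le_lessD by blast
  then have ex: "\<exists>n. j < block_start k n"
    by blast
  define m where "m = (LEAST n. j < block_start k n)"
  have m: "j < block_start k m"
    unfolding m_def using ex by (rule LeastI_ex)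
  obtain i where i: "m = Suc i"
    using m by (cases m) (simp_all add: block_start_def)
  then have "\<not> j < block_start k i"
    unfolding m_def by (intro not_less_Least) simp
  then show ?thesis
    using m i by (intro that[of i]) simp_all
qed

lemma op_block_index:
  assumes "block_start k i \<le> l" "l < block_start k (Suc i)"
    and "block_start k j \<le> m" "m < block_start k (Suc j)"
  shows "op_block e k S i j $$ (l - block_start k i, m - block_start k j) = cinner (e l) (S (e m))"
  using assms by (simp add: op_block_def block_start_Suc)

text \<open>Between the first \<open>n\<close> blocks and the blocks after block \<open>n\<close> (numbered from \<open>0\<close>) the
  distance of block numbers is at least two.\<close>

lemma block_tridiagonal_far:
  assumes k: "\<And>n. k n > 0" and tri: "block_tridiagonal e k S"
    and l: "l < block_start k n" and m: "block_start k (Suc n) \<le> m"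
  shows "cinner (e l) (S (e m)) = 0" "cinner (e m) (S (e l)) = 0"
proof -
  obtain i where i: "block_start k i \<le> l" "l < block_start k (Suc i)"
    using block_of_index[OF k] .
  obtain j where j: "block_start k j \<le> m" "m < block_start k (Suc j)"
    using block_of_index[OF k] .
  have "i < n"
    using i(1) l block_start_mono[of n i k] by (meson leD le_less_trans not_le_imp_less)
  moreover have "Suc n < Suc j"
    using j(2) m block_start_mono[of "Suc j" "Suc n" k] by (meson leD le_less_trans not_le_imp_less)
  ultimately have "op_block e k S i j = 0\<^sub>m (k i) (k j)" "op_block e k S j i = 0\<^sub>m (k j) (k i)"
    using tri by (simp_all add: block_tridiagonal_def)
  then show "cinner (e l) (S (e m)) = 0" "cinner (e m) (S (e l)) = 0"
    using op_block_index[OF i j, of e S] op_block_index[OF j i, of e S] i j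
    by (simp_all add: block_start_Suc)
qed

text \<open>The diagonal of \<open>C Z - Z C\<close> consists of the row sums of \<open>g l j = c\<^sub>l\<^sub>j z\<^sub>j\<^sub>l - z\<^sub>l\<^sub>j c\<^sub>j\<^sub>l\<close>.
  Both products in \<open>g l j\<close> contain one entry of \<open>C\<close> and one of \<open>Z\<close> at mirrored positions, so
  \<open>g l j\<close> vanishes at nonneighbouring blocks even if only one of the two operators is block
  tridiagonal. Hence all sums are finite. As \<open>g\<close> is antisymmetric, its sum over the square of
  indices below the cut cancels, and all that crosses the cut is the single rectangle between
  blocks \<open>n\<close> and \<open>n + 1\<close>.\<close>

lemma commutator_trace_blocks:
  assumes e: "orthonormal_basis e" and C: "bounded_clinear C" and Z: "bounded_clinear Z"
    and k: "\<And>n. k n > 0" and tri: "block_tridiagonal e k C \<or> block_tridiagonal e k Z"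
  shows "(\<Sum>l<block_start k (Suc n). cinner (e l) (C (Z (e l)) - Z (C (e l))))
    = mat_trace (op_block e k C n (Suc n) * op_block e k Z (Suc n) n
        - op_block e k Z n (Suc n) * op_block e k C (Suc n) n)"
proof -
  define c where "c l j = cinner (e l) (C (e j))" for l j
  define z where "z l j = cinner (e l) (Z (e j))" for l j
  define g where "g l j = c l j * z j l - z l j * c j l" for l j
  let ?s = "block_start k"
  have far: "g l j = 0" if "l < ?s m" "?s (Suc m) \<le> j" for l j m
    using tri
  proof
    assume "block_tridiagonal e k C"
    from block_tridiagonal_far[OF k this that] show ?thesis
      by (simp add: g_def c_def)
  next
    assume "block_tridiagonal e k Z"
    from block_tridiagonal_far[OF k this that] show ?thesis
      by (simp add: g_def z_def)
  qed
  have diag: "cinner (e l) (C (Z (e l)) - Z (C (e l))) = (\<Sum>j<?s (Suc (Suc n)). g l j)"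
    if l: "l < ?s (Suc n)" for l
  proof -
    have "(\<lambda>j. g l j) sums (cinner (e l) (C (Z (e l))) - cinner (e l) (Z (C (e l))))"
      unfolding g_def c_def z_def by (intro sums_diff sums_operator_coefficients e C Z)
    moreover have "(\<lambda>j. g l j) sums (\<Sum>j<?s (Suc (Suc n)). g l j)"
      using far[OF l] by (intro sums_finite) auto
    ultimately show ?thesis
      by (simp add: cinner_diff_right sums_unique2)
  qed
  have split: "(\<Sum>j<?s (Suc m). f j) = (\<Sum>j<?s m. f j) + (\<Sum>b<k m. f (?s m + b))" for f :: "nat \<Rightarrow> complex" and m
  proof -
    have "(\<Sum>j<M + N. f j) = (\<Sum>j<M. f j) + (\<Sum>b<N. f (M + b))" for M N
      by (induction N) (simp_all add: add.assoc)
    then show ?thesis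
      by (simp add: block_start_Suc)
  qed
  have anti: "(\<Sum>l<N. \<Sum>j<N. g l j) = 0" for N
  proof -
    have "(\<Sum>l<N. \<Sum>j<N. c l j * z j l) = (\<Sum>l<N. \<Sum>j<N. c j l * z l j)"
      by (rule sum.swap)
    then show ?thesis
      by (simp add: g_def sum_subtractf mult.commute)
  qed
  have "(\<Sum>l<?s (Suc n). cinner (e l) (C (Z (e l)) - Z (C (e l))))
      = (\<Sum>l<?s (Suc n). \<Sum>j<?s (Suc (Suc n)). g l j)"
    using diag by simp
  also have "\<dots> = (\<Sum>l<?s (Suc n). \<Sum>b<k (Suc n). g l (?s (Suc n) + b))"
    using anti by (simp add: split[of _ "Suc n"] sum.distrib)
  also have "\<dots> = (\<Sum>a<k n. \<Sum>b<k (Suc n). g (?s n + a) (?s (Suc n) + b))"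
    using far[of _ n] by (simp add: split[of _ n])
  also have "\<dots> = mat_trace (op_block e k C n (Suc n) * op_block e k Z (Suc n) n
        - op_block e k Z n (Suc n) * op_block e k C (Suc n) n)"
    by (simp add: mat_trace_def op_block_def scalar_prod_def g_def c_def z_def sum_subtractf lessThan_atLeast0)
  finally show ?thesis .
qed

text \<open>A block is a compression of \<open>Z\<close>: a coordinate vector embeds isometrically into the Hilbert
  space, and reading off coordinates does not increase norms, by Bessel.\<close>

lemma mat_bounded_op_block:
  assumes e: "orthonormal e" and Z: "bounded_clinear Z"
  shows "mat_bounded (onorm Z) (op_block e k Z i j)"
  unfolding mat_bounded_def
proof
  fix v :: "complex vec" assume "v \<in> carrier_vec (dim_col (op_block e k Z i j))"
  then have v: "v \<in> carrier_vec (k j)"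
    by (simp add: op_block_def)
  let ?s = "block_start k"
  let ?M = "op_block e k Z i j"
  have shift: "orthonormal (\<lambda>b. e (r + b))" for r
    using e by (simp add: orthonormal_def)
  define x where "x = (\<Sum>b<k j. v $ b *\<^sub>C e (?s j + b))"
  have x: "norm x = vec_norm2 v"
  proof -
    have "(norm x)\<^sup>2 = (vec_norm2 v)\<^sup>2"
      using v unfolding x_def
      by (subst norm_orthonormal_sum[OF shift]) (simp_all add: vec_norm2_def sum_nonneg)
    then show ?thesis
      by (simp add: power2_eq_iff_nonneg)
  qed
  have Mv: "(?M *\<^sub>v v) $ a = cinner (e (?s i + a)) (Z x)" if "a < k i" for a
    using that v unfolding x_def bounded_clinear_sum[OF Z]
    by (simp add: op_block_def scalar_prod_def cinner_sum_right cinner_scaleC_right mult.commute lessThan_atLeast0)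
  have "(vec_norm2 (?M *\<^sub>v v))\<^sup>2 = (\<Sum>a<k i. (cmod ((?M *\<^sub>v v) $ a))\<^sup>2)"
    unfolding vec_norm2_def by (subst real_sqrt_pow2) (simp_all add: sum_nonneg op_block_def)
  also have "\<dots> = (\<Sum>a<k i. (cmod (cinner (e (?s i + a)) (Z x)))\<^sup>2)"
    by (intro sum.cong refl) (simp only: Mv lessThan_iff)
  also have "\<dots> \<le> (norm (Z x))\<^sup>2"
    by (rule bessel_inequality[OF shift]) simp
  finally have "vec_norm2 (?M *\<^sub>v v) \<le> norm (Z x)"
    by (rule power2_le_imp_le) simp
  also have "\<dots> \<le> onorm Z * norm x"
    using Z by (intro onorm) (simp add: bounded_clinear_def)
  finally show "vec_norm2 (?M *\<^sub>v v) \<le> onorm Z * vec_norm2 v"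
    by (simp add: x)
qed

section \<open>The trace estimate\<close>

theorem theorem3p1:
  fixes C Z T :: "'a::complex_hilbert_space \<Rightarrow> 'a"
    and e :: "nat \<Rightarrow> 'a"
    and k :: "nat \<Rightarrow> nat"
    and A B X Y :: "nat \<Rightarrow> complex mat"
    and Q :: "nat \<Rightarrow> 'a \<Rightarrow> 'a"
  assumes "bounded_clinear C" and "bounded_clinear Z"
    and "T = (\<lambda>x. C (Z x) - Z (C x))"
    and "orthonormal_basis e"
    and "\<And>n. k n > 0"
    and "\<And>n. A n = op_block e k C n (Suc n)"
    and "\<And>n. B n = op_block e k C (Suc n) n"
    and "\<And>n. X n = op_block e k Z n (Suc n)"
    and "\<And>n. Y n = op_block e k Z (Suc n) n"
    and "\<And>n. Q n = orth_proj (complex_vector.span (e ` {..<block_start k (Suc n)}))"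
    and "block_tridiagonal e k C \<or> block_tridiagonal e k Z"
  shows "\<forall>n. cmod (op_trace (Q n \<circ> T \<circ> Q n)) \<le> trace_norm (A n * Y n - X n * B n)
    \<and> trace_norm (A n * Y n - X n * B n) \<le> (trace_norm (A n) + trace_norm (B n)) * onorm Z
    \<and> (trace_norm (A n) + trace_norm (B n)) * onorm Z
        \<le> real (k n) * (mat_opnorm (A n) + mat_opnorm (B n)) * onorm Z"
proof (intro allI conjI)
  fix n
  note C = assms(1) and Z = assms(2) and e = assms(4)
  have on: "orthonormal e"
    using e by (simp add: orthonormal_basis_iff)
  have A: "A n \<in> carrier_mat (k n) (k (Suc n))" and X: "X n \<in> carrier_mat (k n) (k (Suc n))"
    and B: "B n \<in> carrier_mat (k (Suc n)) (k n)" and Y: "Y n \<in> carrier_mat (k (Suc n)) (k n)"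
    by (simp_all add: assms(6-9) op_block_def)
  have Z0: "0 \<le> onorm Z"
    using Z by (intro onorm_pos_le) (simp add: bounded_clinear_def)
  have T: "bounded_clinear T"
    unfolding assms(3) by (rule bounded_clinear_commutator[OF C Z])
  have "op_trace (Q n \<circ> T \<circ> Q n) = (\<Sum>l<block_start k (Suc n). cinner (e l) (C (Z (e l)) - Z (C (e l))))"
    unfolding assms(10) op_trace_compression[OF e T finite_lessThan] by (simp add: assms(3))
  also have "\<dots> = mat_trace (A n * Y n - X n * B n)"
    unfolding assms(6-9) by (rule commutator_trace_blocks[OF e C Z assms(5) assms(11)])
  finally show "cmod (op_trace (Q n \<circ> T \<circ> Q n)) \<le> trace_norm (A n * Y n - X n * B n)"
    using cmod_mat_trace_le_trace_norm[OF minus_carrier_mat[OF mult_carrier_mat[OF X B]]] by simp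
  show "trace_norm (A n * Y n - X n * B n) \<le> (trace_norm (A n) + trace_norm (B n)) * onorm Z"
    using mat_bounded_op_block[OF on Z] unfolding assms(8,9)
    by (intro trace_norm_diff_products[OF A Y[unfolded assms(9)] X[unfolded assms(8)] B] Z0)
  have "trace_norm (A n) \<le> k n * mat_opnorm (A n)" "trace_norm (B n) \<le> k n * mat_opnorm (B n)"
    using trace_norm_le_bound(1)[OF A mat_bounded_opnorm mat_opnorm_nonneg]
      trace_norm_le_bound(2)[OF B mat_bounded_opnorm mat_opnorm_nonneg] by auto
  then have "trace_norm (A n) + trace_norm (B n) \<le> real (k n) * (mat_opnorm (A n) + mat_opnorm (B n))"
    by (simp add: distrib_left)
  then show "(trace_norm (A n) + trace_norm (B n)) * onorm Z
      \<le> real (k n) * (mat_opnorm (A n) + mat_opnorm (B n)) * onorm Z"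
    by (rule mult_right_mono[OF _ Z0])
qed

end
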